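(* Let $n,k,m\in\mathbb N$ with $n\ge1$, $m\ge 2$ and $1\le k\le m-1$. Assume that $1\le p\le q<\infty$, and that $r\in\mathbb R$ satisfies $$r\ <\ \frac qp\,(n-1)-n+q.$$ Then there exists a bounded open set $\Omega\subset\mathbb R^n$ with smooth boundary such that, with the associated function $d:\Omega\to(0,\infty)$ as described in the context, there is no constant $C$ such that $$\left\|\frac{u}{d^{\,m-k}}\right\|_{W^{k,q}(\Omega,d^{r})}\ \le\ C\,\|u\|_{W^{m,p}(\Omega,d^{p-1})}$$ for every $u\in W^{m,p}_0(\Omega,d^{p-1})$.
   Context: The function $d$: for a bounded open set $\Omega\subset\mathbb R^n$ with smooth ($C^\infty$) boundary, the distance function $x\mapsto \mathrm{dist}(x,\partial\Omega)$ is smooth in a sufficiently narrow neighborhood of $\partial\Omega$ in $\Omega$. One fixes a function $d:\Omega\to(0,\infty)$ which agrees with the distance function from $\partial\Omega$ in such a neighborhood of $\partial\Omega$, and which is smooth in the whole of $\Omega$. Weighted spaces: for $p\in[1,\infty)$ and $\alpha\in\mathbb R$, $L^p(\Omega,d^\alpha)$ is the space with norm $\|u\|_{L^p(\Omega,d^\alpha)}=\big(\int_\Omega|u(x)|^p d(x)^\alpha\,dx\big)^{1/p}$ for measurable $u$ on $\Omega$. For $m\in\mathbb N$, $W^{m,p}(\Omega,d^\alpha)$ is the space of $m$-times weakly differentiable functions $u$ in $\Omega$ with finite norm $\|u\|_{W^{m,p}(\Omega,d^\alpha)}=\sum_{j=0}^m\|\nabla^j u\|_{L^p(\Omega,d^\alpha)}$,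 where $\nabla^j u$ is the vector of all derivatives of $u$ of order $j$, and $\nabla^0u=u$. $W^{m,p}_0(\Omega,d^\alpha)$ is the closure of $C_0^\infty(\Omega)$ (smooth functions with compact support in $\Omega$) in $W^{m,p}(\Omega,d^\alpha)$. *)

theory Defs
  imports "HOL-Analysis.Analysis"
begin

section \<open>Classical derivatives and smooth functions\<close>

definition partial :: "'n::finite \<Rightarrow> (real^'n \<Rightarrow> real) \<Rightarrow> real^'n \<Rightarrow> real" where
  "partial i f x = frechet_derivative f (at x) (axis i 1)"

text \<open>Partial derivatives of order \<open>j\<close> are indexed by lists of \<open>j\<close> coordinate directions, i.e. by
  the components of the \<open>j\<close>-th derivative tensor.\<close>

definition partials :: "'n::finite list \<Rightarrow> (real^'n \<Rightarrow> real) \<Rightarrow> real^'n \<Rightarrow> real" where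
  "partials I f = foldr partial I f"

text \<open>For open \<open>S\<close> this is \<open>C\<^sup>\<infinity>\<close> on \<open>S\<close>: differentiability of all iterated partial derivatives
  contains both their existence and their continuity.\<close>

definition smooth_on :: "(real^'n::finite) set \<Rightarrow> (real^'n \<Rightarrow> real) \<Rightarrow> bool" where
  "smooth_on S f \<longleftrightarrow> (\<forall>I. \<forall>x\<in>S. partials I f differentiable (at x))"

definition test_function :: "(real^'n::finite) set \<Rightarrow> (real^'n \<Rightarrow> real) \<Rightarrow> bool" where
  "test_function \<Omega> \<phi> \<longleftrightarrow> smooth_on UNIV \<phi> \<and>
     compact (closure {x. \<phi> x \<noteq> 0}) \<and> closure {x. \<phi> x \<noteq> 0} \<subseteq> \<Omega>"


section \<open>Domains with smooth boundary and the regularised distance\<close>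

text \<open>Near each boundary point, \<open>\<Omega>\<close> is the sublevel set of a smooth function without critical points;
  by the implicit function theorem this says that \<open>\<Omega>\<close> lies locally on one side of a smooth
  hypersurface.\<close>

definition smooth_boundary :: "(real^'n::finite) set \<Rightarrow> bool" where
  "smooth_boundary \<Omega> \<longleftrightarrow>
     (\<forall>x\<in>frontier \<Omega>. \<exists>U \<rho>. open U \<and> x \<in> U \<and> smooth_on U \<rho> \<and>
        (\<forall>y\<in>U. \<exists>i. partial i \<rho> y \<noteq> 0) \<and>
        \<Omega> \<inter> U = {y\<in>U. \<rho> y < 0} \<and> frontier \<Omega> \<inter> U = {y\<in>U. \<rho> y = 0})"

text \<open>As the boundary of a bounded set is compact, its neighbourhoods in \<open>\<Omega>\<close> are exactly the sets
  containing some strip \<open>{x\<in>\<Omega>. infdist x (frontier \<Omega>) < \<epsilon>}\<close>.\<close>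

definition regularised_distance :: "(real^'n::finite) set \<Rightarrow> (real^'n \<Rightarrow> real) \<Rightarrow> bool" where
  "regularised_distance \<Omega> d \<longleftrightarrow> smooth_on \<Omega> d \<and> (\<forall>x\<in>\<Omega>. 0 < d x) \<and>
     (\<exists>\<epsilon>>0. \<forall>x\<in>\<Omega>. infdist x (frontier \<Omega>) < \<epsilon> \<longrightarrow> d x = infdist x (frontier \<Omega>))"


section \<open>Weak derivatives\<close>

text \<open>Functions on \<open>\<Omega>\<close> are represented by functions on the whole space whose values outside \<open>\<Omega>\<close> are
  irrelevant, and they are not identified when they agree almost everywhere.\<close>

definition locally_integrable :: "(real^'n::finite) set \<Rightarrow> (real^'n \<Rightarrow> real) \<Rightarrow> bool" where
  "locally_integrable \<Omega> u \<longleftrightarrow> (\<forall>K. compact K \<and> K \<subseteq> \<Omega> \<longrightarrow> set_integrable lebesgue K u)"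

definition is_weak_partial ::
    "(real^'n::finite) set \<Rightarrow> 'n list \<Rightarrow> (real^'n \<Rightarrow> real) \<Rightarrow> (real^'n \<Rightarrow> real) \<Rightarrow> bool" where
  "is_weak_partial \<Omega> I u v \<longleftrightarrow> locally_integrable \<Omega> u \<and> locally_integrable \<Omega> v \<and>
     (\<forall>\<phi>. test_function \<Omega> \<phi> \<longrightarrow>
        (LINT x:\<Omega>|lebesgue. u x * partials I \<phi> x) =
        (-1) ^ length I * (LINT x:\<Omega>|lebesgue. v x * \<phi> x))"

definition weakly_differentiable :: "nat \<Rightarrow> (real^'n::finite) set \<Rightarrow> (real^'n \<Rightarrow> real) \<Rightarrow> bool" where
  "weakly_differentiable m \<Omega> u \<longleftrightarrow> (\<forall>I. length I \<le> m \<longrightarrow> (\<exists>v. is_weak_partial \<Omega> I u v))"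

text \<open>The choice is unique up to null sets in \<open>\<Omega>\<close>; for the empty list \<open>u\<close> itself is taken.\<close>

definition weak_partial :: "(real^'n::finite) set \<Rightarrow> 'n list \<Rightarrow> (real^'n \<Rightarrow> real) \<Rightarrow> real^'n \<Rightarrow> real" where
  "weak_partial \<Omega> I u = (if I = [] then u else (SOME v. is_weak_partial \<Omega> I u v))"

text \<open>The Euclidean length of \<open>\<nabla>\<^sup>j u\<close>.\<close>

definition grad_norm :: "(real^'n::finite) set \<Rightarrow> nat \<Rightarrow> (real^'n \<Rightarrow> real) \<Rightarrow> real^'n \<Rightarrow> real" where
  "grad_norm \<Omega> j u x = sqrt (\<Sum>I\<in>{I. length I = j}. (weak_partial \<Omega> I u x)\<^sup>2)"


section \<open>Weighted Lebesgue and Sobolev spaces\<close>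

definition ennpowr :: "ennreal \<Rightarrow> real \<Rightarrow> ennreal" where
  "ennpowr t a = (if t = \<infinity> then \<infinity> else ennreal (enn2real t powr a))"

text \<open>Norms take values in \<open>[0, \<infinity>]\<close>; a function lies in the space iff its norm is finite. The argument
  \<open>w\<close> is the weight.\<close>

definition Lp_norm :: "real \<Rightarrow> (real^'n::finite) set \<Rightarrow> (real^'n \<Rightarrow> real) \<Rightarrow> (real^'n \<Rightarrow> real) \<Rightarrow> ennreal" where
  "Lp_norm p \<Omega> w f =
     ennpowr (\<integral>\<^sup>+ x. ennreal (\<bar>f x\<bar> powr p * w x) \<partial>lebesgue_on \<Omega>) (1 / p)"

definition sobolev_norm ::
    "nat \<Rightarrow> real \<Rightarrow> (real^'n::finite) set \<Rightarrow> (real^'n \<Rightarrow> real) \<Rightarrow> (real^'n \<Rightarrow> real) \<Rightarrow> ennreal" where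
  "sobolev_norm m p \<Omega> w u =
     (if weakly_differentiable m \<Omega> u then \<Sum>j\<le>m. Lp_norm p \<Omega> w (grad_norm \<Omega> j u) else \<infinity>)"

definition sobolev_space ::
    "nat \<Rightarrow> real \<Rightarrow> (real^'n::finite) set \<Rightarrow> (real^'n \<Rightarrow> real) \<Rightarrow> (real^'n \<Rightarrow> real) set" where
  "sobolev_space m p \<Omega> w = {u. sobolev_norm m p \<Omega> w u < \<infinity>}"

text \<open>The closure of the test functions in \<open>sobolev_space m p \<Omega> w\<close>.\<close>

definition sobolev_space0 ::
    "nat \<Rightarrow> real \<Rightarrow> (real^'n::finite) set \<Rightarrow> (real^'n \<Rightarrow> real) \<Rightarrow> (real^'n \<Rightarrow> real) set" where
  "sobolev_space0 m p \<Omega> w = {u \<in> sobolev_space m p \<Omega> w.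
     \<forall>\<epsilon>>0. \<exists>\<phi>. test_function \<Omega> \<phi> \<and> sobolev_norm m p \<Omega> w (\<lambda>x. u x - \<phi> x) < ennreal \<epsilon>}"

end

theory Submission
  imports Defs "HOL-Computational_Algebra.Polynomial" "HOL-Real_Asymp.Real_Asymp"
begin

text \<open>Scaling. Let \<open>\<Omega>\<close> be the unit ball, \<open>\<psi>\<close> a bump of width \<open>e\<close> at distance of order \<open>e\<close> from the
  sphere, and \<open>u\<close> a partial derivative of \<open>\<psi>\<close> of order \<open>k\<close>. Up to constants, the norm on the right-hand
  side is at most \<open>e powr ((n + p - 1) / p - (m + k))\<close>, while the norm on the left-hand side is at least
  \<open>e powr ((n + r) / q - (m + k))\<close>. The assumption on \<open>r\<close> says precisely that
  \<open>(n + r) / q < (n + p - 1) / p\<close>, so the quotient of the norms is unbounded as \<open>e\<close> tends to \<open>0\<close>.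

  The bumps are products of functions of one coordinate, given together with the sequences of their
  derivatives: for these, iterated partial derivatives are explicit and commute.\<close>

section \<open>Smooth functions on open sets\<close>

text \<open>The two estimates use weak derivatives in opposite ways. The lower bound holds for
  whichever weak derivative \<open>SOME\<close> picks: pairing the one of
  \<open>u / d ^ (m - k)\<close> with \<open>\<psi>\<close> moves all derivatives onto
  \<open>\<psi>\<close>, where the classical ones are known. For the upper bound the derivatives
  picked by \<open>SOME\<close> must be identified almost everywhere with the classical ones, and
  this is what calls for integration by parts and the fundamental lemma of the calculus of
  variations. The common exponent \<open>- (m + k)\<close> has two origins. On the right,
  \<open>u\<close> already carries \<open>k\<close> derivatives and receives at most
  \<open>m\<close> more, each costing \<open>1 / e\<close>. On the left, the paired integrand is the
  square of a \<open>k\<close>-th derivative divided by \<open>d ^ (m - k)\<close>, of size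
  \<open>e powr (- (2 * k + (m - k)))\<close>. These contributions cancel in the quotient, so that
  only volume and weight remain: \<open>n + p - 1\<close> against \<open>n + r\<close>, to the
  powers \<open>1 / p\<close> and \<open>1 / q\<close>.\<close>

lemma partial_eqI:
  assumes "(f has_derivative f') (at x)"
  shows "partial i f x = f' (axis i 1)"
  unfolding partial_def by (simp add: frechet_derivative_at[OF assms, symmetric])

text \<open>\<open>frechet_derivative\<close> is a choice from the set of derivatives at
  \<open>x\<close>. This set depends only on the function near \<open>x\<close>, so the choices
  coincide even where no derivative exists.\<close>

lemma partial_cong:
  assumes "open S" "x \<in> S" "\<And>y. y \<in> S \<Longrightarrow> f y = g y"
  shows "partial i f x = partial i g x"
proof -
  have "(f has_derivative D) (at x) \<longleftrightarrow> (g has_derivative D) (at x)" for D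
  proof
    show "(g has_derivative D) (at x)" if "(f has_derivative D) (at x)"
      by (rule has_derivative_transform_within_open[OF that assms(1,2)]) (simp add: assms(3))
    show "(f has_derivative D) (at x)" if "(g has_derivative D) (at x)"
      by (rule has_derivative_transform_within_open[OF that assms(1,2)]) (simp add: assms(3))
  qed
  then show ?thesis
    by (simp add: partial_def frechet_derivative_def)
qed

lemma partials_Nil [simp]: "partials [] f = f"
  by (simp add: partials_def)

lemma partials_Cons: "partials (i # I) f = partial i (partials I f)"
  by (simp add: partials_def)

lemma partials_snoc: "partials (I @ [i]) f = partials I (partial i f)"
  by (simp add: partials_def)

text \<open>The recursion peels off the innermost derivative, whereas
  \<open>partials (i # I)\<close> adds an outermost one. In this form sum, product and chain rule
  rewrite \<open>partial i\<close> of a compound function, and induction on the order applies to the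
  pieces.\<close>

primrec diff_n :: "nat \<Rightarrow> (real^'n::finite) set \<Rightarrow> (real^'n \<Rightarrow> real) \<Rightarrow> bool" where
  "diff_n 0 S f \<longleftrightarrow> (\<forall>x\<in>S. f differentiable (at x))"
| "diff_n (Suc n) S f \<longleftrightarrow> (\<forall>x\<in>S. f differentiable (at x)) \<and> (\<forall>i. diff_n n S (partial i f))"

lemma diff_n_iff: "diff_n n S f \<longleftrightarrow> (\<forall>I. length I \<le> n \<longrightarrow> (\<forall>x\<in>S. partials I f differentiable (at x)))"
proof (induction n arbitrary: f)
  case 0
  then show ?case by simp
next
  case (Suc n)
  have "(\<forall>I::'a list. length I \<le> Suc n \<longrightarrow> P I) \<longleftrightarrow> P [] \<and> (\<forall>i I. length I \<le> n \<longrightarrow> P (I @ [i]))"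
    for P :: "'a list \<Rightarrow> bool"
  proof (intro iffI allI impI)
    fix I :: "'a list"
    assume "P [] \<and> (\<forall>i I. length I \<le> n \<longrightarrow> P (I @ [i]))" "length I \<le> Suc n"
    then show "P I" by (cases I rule: rev_cases) auto
  qed auto
  from this[of "\<lambda>I. \<forall>x\<in>S. partials I f differentiable (at x)"] show ?case
    by (simp add: Suc.IH partials_snoc)
qed

lemma smooth_on_iff_diff_n: "smooth_on S f \<longleftrightarrow> (\<forall>n. diff_n n S f)"
  by (auto simp: smooth_on_def diff_n_iff)

lemma diff_n_mono: "diff_n (Suc n) S f \<Longrightarrow> diff_n n S f"
  by (auto simp: diff_n_iff)

lemma differentiable_cong_open:
  assumes "open S" "x \<in> S" "\<And>y. y \<in> S \<Longrightarrow> f y = g y" "f differentiable (at x)"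
  shows "g differentiable (at x)"
proof -
  obtain D where "(f has_derivative D) (at x)"
    using assms(4) by (auto simp: differentiable_def)
  then have "(g has_derivative D) (at x)"
    by (rule has_derivative_transform_within_open[OF _ assms(1,2)]) (simp add: assms(3))
  then show ?thesis by (auto simp: differentiable_def)
qed

lemma diff_n_cong:
  assumes "open S" "\<And>x. x \<in> S \<Longrightarrow> f x = g x" "diff_n n S f"
  shows "diff_n n S g"
  using assms(2,3)
proof (induction n arbitrary: f g)
  case 0
  then show ?case
    using differentiable_cong_open[OF assms(1), of _ f g] by auto
next
  case (Suc n)
  have "partial i f x = partial i g x" if "x \<in> S" for i x
    by (rule partial_cong[OF assms(1) that]) (simp add: Suc.prems)
  then have "diff_n n S (partial i g)" for i
    by (rule Suc.IH[of "partial i f"]) (use Suc.prems(2) in simp_all)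
  moreover have "\<forall>x\<in>S. g differentiable at x"
    using differentiable_cong_open[OF assms(1), of _ f g] Suc.prems by auto
  ultimately show ?case by simp
qed

lemma partial_add:
  assumes "f differentiable (at x)" "g differentiable (at x)"
  shows "partial i (\<lambda>x. f x + g x) x = partial i f x + partial i g x"
proof -
  have f: "(f has_derivative frechet_derivative f (at x)) (at x)"
    and g: "(g has_derivative frechet_derivative g (at x)) (at x)"
    using assms by (simp_all add: frechet_derivative_works)
  show ?thesis
    by (subst partial_eqI[OF has_derivative_add[OF f g]]) (simp add: partial_def)
qed

lemma partial_mult:
  assumes "f differentiable (at x)" "g differentiable (at x)"
  shows "partial i (\<lambda>x. f x * g x) x = partial i f x * g x + f x * partial i g x"
proof -
  have f: "(f has_derivative frechet_derivative f (at x)) (at x)"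
    and g: "(g has_derivative frechet_derivative g (at x)) (at x)"
    using assms by (simp_all add: frechet_derivative_works)
  show ?thesis
    by (subst partial_eqI[OF has_derivative_mult[OF f g]]) (simp add: partial_def)
qed

lemma partial_comp:
  assumes "f differentiable (at x)" "(s has_real_derivative s') (at (f x))"
  shows "partial i (\<lambda>x. s (f x)) x = s' * partial i f x"
proof -
  have f: "(f has_derivative frechet_derivative f (at x)) (at x)"
    using assms by (simp add: frechet_derivative_works)
  have s: "(s has_derivative (*) s') (at (f x))"
    using assms(2) by (simp add: has_field_derivative_def)
  show ?thesis
    by (subst partial_eqI[OF has_derivative_compose[OF f s]]) (simp add: partial_def)
qed

lemma partial_const [simp]: "partial i (\<lambda>_. c) = (\<lambda>_. 0)"
  by (rule ext) (simp add: partial_eqI[OF has_derivative_const])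

lemma partial_nth [simp]: "partial i (\<lambda>x. x $ j) = (\<lambda>_. if i = j then 1 else 0)"
proof
  fix x :: "real^'a"
  have "((\<lambda>x. x $ j) has_derivative (\<lambda>x. x $ j)) (at x)"
    by (rule bounded_linear.has_derivative[OF bounded_linear_vec_nth]) simp
  then show "partial i (\<lambda>x. x $ j) x = (if i = j then 1 else 0)"
    by (simp add: partial_eqI axis_def)
qed

lemma diff_n_const: "diff_n n S (\<lambda>_. c)"
  by (induction n arbitrary: c) auto

lemma diff_n_nth: "diff_n n S (\<lambda>x. x $ j)"
  by (cases n) (auto simp: diff_n_const intro!: bounded_linear_imp_differentiable bounded_linear_vec_nth)

lemma diff_n_add:
  assumes "open S" "diff_n n S f" "diff_n n S g"
  shows "diff_n n S (\<lambda>x. f x + g x)"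
  using assms(2,3)
proof (induction n arbitrary: f g)
  case (Suc n)
  have "diff_n n S (partial i (\<lambda>x. f x + g x))" for i
    by (rule diff_n_cong[OF assms(1) _ Suc.IH[of "partial i f" "partial i g"]])
       (use Suc.prems in \<open>auto simp: partial_add\<close>)
  with Suc.prems show ?case by auto
qed auto

lemma diff_n_mult:
  assumes "open S" "diff_n n S f" "diff_n n S g"
  shows "diff_n n S (\<lambda>x. f x * g x)"
  using assms(2,3)
proof (induction n arbitrary: f g)
  case (Suc n)
  have "diff_n n S (partial i (\<lambda>x. f x * g x))" for i
    by (rule diff_n_cong[OF assms(1) _ diff_n_add[OF assms(1) Suc.IH[of "partial i f" g] Suc.IH[of f "partial i g"]]])
       (use Suc.prems in \<open>auto simp: partial_mult intro: diff_n_mono\<close>)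
  with Suc.prems show ?case by auto
qed auto

lemma differentiable_comp_real:
  assumes "f differentiable (at x)" "(s has_real_derivative s') (at (f x))"
  shows "(\<lambda>x. s (f x)) differentiable (at x)"
proof -
  have "s differentiable (at (f x))"
    using assms(2) has_field_derivative_def differentiable_def by blast
  then show ?thesis
    using differentiable_chain_at[of f x s] assms(1) by (simp add: o_def)
qed

text \<open>The outer function comes as a sequence of derivatives: the chain rule turns
  \<open>s j\<close> composed with \<open>f\<close> into \<open>s (Suc j)\<close> composed with
  \<open>f\<close>, times \<open>partial i f\<close>, which is the same claim at a lower order and
  another \<open>j\<close>.\<close>

lemma diff_n_comp:
  assumes "open S" "\<And>j t. t \<in> T \<Longrightarrow> (s j has_real_derivative s (Suc j) t) (at t)"
    and "\<And>x. x \<in> S \<Longrightarrow> f x \<in> T" and "diff_n n S f"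
  shows "diff_n n S (\<lambda>x. s j (f x))"
proof -
  have pc: "partial i (\<lambda>x. s j (f x)) x = s (Suc j) (f x) * partial i f x"
    if "x \<in> S" "f differentiable (at x)" for x j i
    by (rule partial_comp[OF that(2) assms(2)]) (rule assms(3)[OF that(1)])
  have d: "(\<lambda>x. s j (f x)) differentiable (at x)" if "x \<in> S" "f differentiable (at x)" for x j
    by (rule differentiable_comp_real[OF that(2) assms(2)]) (rule assms(3)[OF that(1)])
  show ?thesis
    using assms(4)
  proof (induction n arbitrary: j)
    case 0
    then show ?case
      using d by auto
  next
    case (Suc n)
    have "diff_n n S (partial i (\<lambda>x. s j (f x)))" for i
      by (rule diff_n_cong[OF assms(1) _ diff_n_mult[OF assms(1) Suc.IH[of "Suc j"], of "partial i f"]])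
         (use Suc.prems in \<open>auto simp: pc intro: diff_n_mono\<close>)
    with Suc.prems show ?case
      using d by auto
  qed
qed

lemma smooth_on_const: "smooth_on S (\<lambda>_. c)"
  by (simp add: smooth_on_iff_diff_n diff_n_const)

lemma smooth_on_nth: "smooth_on S (\<lambda>x. x $ j)"
  by (simp add: smooth_on_iff_diff_n diff_n_nth)

lemma smooth_on_add: "open S \<Longrightarrow> smooth_on S f \<Longrightarrow> smooth_on S g \<Longrightarrow> smooth_on S (\<lambda>x. f x + g x)"
  by (simp add: smooth_on_iff_diff_n diff_n_add)

lemma smooth_on_mult: "open S \<Longrightarrow> smooth_on S f \<Longrightarrow> smooth_on S g \<Longrightarrow> smooth_on S (\<lambda>x. f x * g x)"
  by (simp add: smooth_on_iff_diff_n diff_n_mult)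

lemma smooth_on_comp:
  assumes "open S" "\<And>j t. t \<in> T \<Longrightarrow> (s j has_real_derivative s (Suc j) t) (at t)"
    and "\<And>x. x \<in> S \<Longrightarrow> f x \<in> T" and "smooth_on S f"
  shows "smooth_on S (\<lambda>x. s j (f x))"
  using assms(4) diff_n_comp[where s = s, OF assms(1,2,3)] by (simp add: smooth_on_iff_diff_n)

lemma smooth_on_sum:
  assumes "open S" "\<And>i. i \<in> A \<Longrightarrow> smooth_on S (f i)"
  shows "smooth_on S (\<lambda>x. \<Sum>i\<in>A. f i x)"
  using assms(2)
  by (induction A rule: infinite_finite_induct) (auto simp: smooth_on_const intro!: smooth_on_add assms(1))

lemma smooth_on_differentiable: "smooth_on S f \<Longrightarrow> x \<in> S \<Longrightarrow> partials I f differentiable (at x)"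
  by (simp add: smooth_on_def)

section \<open>Smoothness of the boundary of the unit ball\<close>

lemma norm_sq_vec: "(norm x)\<^sup>2 = (\<Sum>i\<in>UNIV. x $ i * x $ i)" for x :: "real^'n::finite"
  by (simp add: power2_norm_eq_inner inner_vec_def)

lemma smooth_on_norm_sq: "open S \<Longrightarrow> smooth_on S (\<lambda>x. (norm x)\<^sup>2)"
  unfolding norm_sq_vec by (intro smooth_on_sum smooth_on_mult smooth_on_nth)

lemma partial_norm_sq: "partial i (\<lambda>x. (norm x)\<^sup>2 + c) x = 2 * x $ i" for x :: "real^'n::finite"
proof -
  have "((\<lambda>x. x \<bullet> x + c) has_derivative (\<lambda>h. 2 * (x \<bullet> h))) (at x)"
    by (auto intro!: derivative_eq_intros simp: inner_commute)
  from partial_eqI[OF this] show ?thesis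
    by (simp add: power2_norm_eq_inner inner_axis)
qed

lemma smooth_boundary_unit_ball: "smooth_boundary (ball (0::real^'n::finite) 1)"
  unfolding smooth_boundary_def
proof
  fix x :: "real^'n" assume "x \<in> frontier (ball 0 1)"
  then have x: "norm x = 1" by simp
  \<comment> \<open>The gradient of the defining function is \<open>2 * x\<close>, so the origin,
    its only critical point, is removed; one pair \<open>?U\<close>, \<open>?\<rho>\<close> then
    serves all boundary points.\<close>
  let ?U = "- {0::real^'n}" and ?\<rho> = "\<lambda>x::real^'n. (norm x)\<^sup>2 + (-1)"
  have "\<exists>i. partial i ?\<rho> y \<noteq> 0" if "y \<in> ?U" for y
    using that unfolding partial_norm_sq by (auto simp: vec_eq_iff)
  moreover have "smooth_on ?U ?\<rho>"
    by (intro smooth_on_add smooth_on_norm_sq smooth_on_const) auto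
  moreover have "ball 0 1 \<inter> ?U = {y \<in> ?U. ?\<rho> y < 0}"
    by (auto simp: abs_square_less_1)
  moreover have "frontier (ball 0 1) \<inter> ?U = {y \<in> ?U. ?\<rho> y = 0}"
    by (auto simp: power2_eq_1_iff) (smt (verit) norm_ge_zero)
  ultimately show "\<exists>U \<rho>. open U \<and> x \<in> U \<and> smooth_on U \<rho> \<and> (\<forall>y\<in>U. \<exists>i. partial i \<rho> y \<noteq> 0) \<and>
      ball 0 1 \<inter> U = {y \<in> U. \<rho> y < 0} \<and> frontier (ball 0 1) \<inter> U = {y \<in> U. \<rho> y = 0}"
    using x by (intro exI[of _ ?U] exI[of _ ?\<rho>]) auto
qed

section \<open>Bump functions and the unit ball\<close>

definition deriv_seq :: "real set \<Rightarrow> (nat \<Rightarrow> real \<Rightarrow> real) \<Rightarrow> bool" where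
  "deriv_seq T s \<longleftrightarrow> (\<forall>j. \<forall>t\<in>T. (s j has_real_derivative s (Suc j) t) (at t))"

lemma deriv_seqD: "deriv_seq T s \<Longrightarrow> t \<in> T \<Longrightarrow> (s j has_real_derivative s (Suc j) t) (at t)"
  by (simp add: deriv_seq_def)

text \<open>For \<open>t > 0\<close> the \<open>j\<close>-th derivative of
  \<open>exp (- c / t)\<close> is \<open>P_j(s) * exp (- c * s)\<close> with
  \<open>s = 1 / t\<close>. As \<open>ds/dt = - s^2\<close>, differentiating once more gives
  \<open>P_(j+1) = s^2 * (c * P_j - P_j')\<close>.\<close>

primrec exp_inv_poly :: "real \<Rightarrow> nat \<Rightarrow> real poly" where
  "exp_inv_poly c 0 = 1"
| "exp_inv_poly c (Suc j) = [:0, 0, 1:] * (smult c (exp_inv_poly c j) - pderiv (exp_inv_poly c j))"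

definition exp_inv :: "real \<Rightarrow> nat \<Rightarrow> real \<Rightarrow> real" where
  "exp_inv c j t = (if 0 < t then poly (exp_inv_poly c j) (1 / t) * exp (- c / t) else 0)"

lemma tendsto_poly_times_exp:
  assumes "(c::real) > 0"
  shows "((\<lambda>s. poly p s * exp (- c * s)) \<longlongrightarrow> 0) at_top"
proof -
  have "((\<lambda>s. coeff p i * (s ^ i * exp (- c * s))) \<longlongrightarrow> coeff p i * 0) at_top" for i
  proof (rule tendsto_mult_left)
    show "((\<lambda>s. s ^ i * exp (- c * s)) \<longlongrightarrow> 0) at_top"
      using assms by real_asymp
  qed
  then have "((\<lambda>s. \<Sum>i\<le>degree p. coeff p i * (s ^ i * exp (- c * s))) \<longlongrightarrow> (\<Sum>i\<le>degree p. coeff p i * 0)) at_top"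
    by (rule tendsto_sum)
  then show ?thesis
    by (simp add: poly_altdef sum_distrib_right mult.assoc)
qed

lemma exp_inv_nonpos [simp]: "t \<le> 0 \<Longrightarrow> exp_inv c j t = 0"
  by (simp add: exp_inv_def)

lemma deriv_seq_exp_inv:
  assumes "c > 0"
  shows "deriv_seq UNIV (exp_inv c)"
  unfolding deriv_seq_def
proof (intro allI ballI)
  fix j :: nat and t :: real
  let ?p = "exp_inv_poly c j"
  consider "t < 0" | "t = 0" | "t > 0" by linarith
  then show "(exp_inv c j has_real_derivative exp_inv c (Suc j) t) (at t)"
  proof cases
    case 1
    have "((\<lambda>_. 0) has_real_derivative 0) (at t)" by simp
    then have "(exp_inv c j has_real_derivative 0) (at t)"
      by (rule has_field_derivative_transform_within_open[where S = "{..<0}"]) (use 1 in auto)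
    then show ?thesis using 1 by simp
  next
    case 2
    \<comment> \<open>In the variable \<open>s = 1 / t\<close> the difference quotient at 0 from the
      right is \<open>s * P_j(s) * exp (- c * s)\<close>; the factor \<open>[:0, 1:]\<close> is the
      division by \<open>t\<close>.\<close>
    have "((\<lambda>s. poly ([:0, 1:] * ?p) s * exp (- c * s)) \<longlongrightarrow> 0) at_top"
      by (rule tendsto_poly_times_exp[OF assms])
    then have "((\<lambda>y. poly ([:0, 1:] * ?p) (inverse y) * exp (- c * inverse y)) \<longlongrightarrow> 0) (at_right 0)"
      by (rule filterlim_compose[OF _ filterlim_inverse_at_top_right])
    then have r: "((\<lambda>y. exp_inv c j y / y) \<longlongrightarrow> 0) (at_right 0)"
      by (rule tendsto_cong[THEN iffD1, rotated])
         (auto simp: eventually_at_filter exp_inv_def divide_inverse)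
    have "((\<lambda>_. 0::real) \<longlongrightarrow> 0) (at_left 0)" by simp
    then have l: "((\<lambda>y. exp_inv c j y / y) \<longlongrightarrow> 0) (at_left 0)"
      by (rule tendsto_cong[THEN iffD1, rotated])
         (auto simp: eventually_at_filter exp_inv_def)
    show ?thesis
      using filterlim_split_at[OF l r] by (simp add: has_field_derivative_iff 2)
  next
    case 3
    have e: "exp_inv c (Suc j) t = poly ?p (1 / t) * (exp (- c / t) * (c / t\<^sup>2))
        + poly (pderiv ?p) (1 / t) * (- 1 / t\<^sup>2) * exp (- c / t)"
      using 3 by (simp add: exp_inv_def field_simps power2_eq_square)
    have d1: "((\<lambda>t. poly ?p (1 / t)) has_real_derivative poly (pderiv ?p) (1 / t) * (- 1 / t\<^sup>2)) (at t)"
      by (rule DERIV_chain2[OF poly_DERIV])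
         (use 3 in \<open>auto intro!: derivative_eq_intros simp: power2_eq_square\<close>)
    have d2: "((\<lambda>t. exp (- c / t)) has_real_derivative exp (- c / t) * (c / t\<^sup>2)) (at t)"
      using 3 by (auto intro!: derivative_eq_intros simp: power2_eq_square)
    have "((\<lambda>t. poly ?p (1 / t) * exp (- c / t)) has_real_derivative
        exp_inv c (Suc j) t) (at t)"
      using DERIV_mult'[OF d1 d2] by (simp only: e)
    then show ?thesis
      by (rule has_field_derivative_transform_within_open[where S = "{0<..}"])
         (use 3 in \<open>auto simp: exp_inv_def\<close>)
  qed
qed

lemma exp_inv_0: "exp_inv c 0 t = (if 0 < t then exp (- c / t) else 0)"
  by (simp add: exp_inv_def)

text \<open>The \<open>n\<close>-th derivative of the product of \<open>F i\<close> and
  \<open>G j\<close>, expanded by applying the product rule \<open>n\<close> times, without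
  collecting equal terms into binomial coefficients.\<close>

primrec leibniz :: "(nat \<Rightarrow> real \<Rightarrow> real) \<Rightarrow> (nat \<Rightarrow> real \<Rightarrow> real) \<Rightarrow> nat \<Rightarrow> nat \<Rightarrow> nat \<Rightarrow> real \<Rightarrow> real" where
  "leibniz F G 0 i j t = F i t * G j t"
| "leibniz F G (Suc n) i j t = leibniz F G n (Suc i) j t + leibniz F G n i (Suc j) t"

lemma deriv_seq_leibniz:
  assumes "deriv_seq T F" "deriv_seq T G"
  shows "deriv_seq T (\<lambda>n. leibniz F G n i j)"
proof -
  have "(leibniz F G n i j has_real_derivative leibniz F G (Suc n) i j t) (at t)" if "t \<in> T" for n t
  proof (induction n arbitrary: i j)
    case 0
    have "((\<lambda>t. F i t * G j t) has_real_derivative F (Suc i) t * G j t + F i t * G (Suc j) t) (at t)"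
      using assms[THEN deriv_seqD, OF that] by (auto intro!: derivative_eq_intros)
    then show ?case by (simp add: fun_eq_iff[THEN iffD2] leibniz.simps(1)[abs_def])
  next
    case (Suc n)
    have "((\<lambda>t. leibniz F G n (Suc i) j t + leibniz F G n i (Suc j) t) has_real_derivative
        leibniz F G (Suc n) (Suc i) j t + leibniz F G (Suc n) i (Suc j) t) (at t)"
      by (intro DERIV_add Suc.IH)
    then show ?case by (simp add: leibniz.simps(2)[abs_def] del: leibniz.simps)
  qed
  then show ?thesis by (simp add: deriv_seq_def)
qed

lemma leibniz_eq_0: "(\<forall>i. F i t = 0) \<or> (\<forall>j. G j t = 0) \<Longrightarrow> leibniz F G n i j t = 0"
  by (induction n arbitrary: i j) auto

lemma deriv_seq_affine:
  assumes "deriv_seq UNIV F"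
  shows "deriv_seq UNIV (\<lambda>j t. a ^ j * F j (a * t + b))"
proof -
  have "((\<lambda>t. a ^ j * F j (a * t + b)) has_real_derivative a ^ Suc j * F (Suc j) (a * t + b)) (at t)" for j t
    by (rule derivative_eq_intros DERIV_chain2[OF deriv_seqD[OF assms UNIV_I]] refl)+ simp
  then show ?thesis by (simp add: deriv_seq_def)
qed

text \<open>The sign \<open>(- 1) ^ j\<close> comes from differentiating the reflected factor. The
  parameter \<open>c\<close> has two uses: fixed at 1 for the scaled bumps, and tending to 0 to
  approximate the indicator of the open interval from \<open>a\<close> to \<open>b\<close>.\<close>

definition bump :: "real \<Rightarrow> real \<Rightarrow> real \<Rightarrow> nat \<Rightarrow> real \<Rightarrow> real" where
  "bump c a b n = leibniz (\<lambda>j t. exp_inv c j (t - a)) (\<lambda>j t. (- 1) ^ j * exp_inv c j (b - t)) n 0 0"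

lemma deriv_seq_bump: "c > 0 \<Longrightarrow> deriv_seq UNIV (bump c a b)"
  using deriv_seq_leibniz[OF deriv_seq_affine[OF deriv_seq_exp_inv, of c 1 "- a"]
      deriv_seq_affine[OF deriv_seq_exp_inv, of c "- 1" b]]
  by (simp add: bump_def[abs_def])

lemma bump_eq_0: "t \<notin> {a<..<b} \<Longrightarrow> bump c a b n t = 0"
  unfolding bump_def by (rule leibniz_eq_0) auto

lemma bump_0: "bump c a b 0 t = (if t \<in> {a<..<b} then exp (- c / (t - a)) * exp (- c / (b - t)) else 0)"
  by (simp add: bump_def exp_inv_0)

section \<open>Products of functions of one coordinate\<close>

definition coord_prod :: "('n::finite \<Rightarrow> nat \<Rightarrow> real \<Rightarrow> real) \<Rightarrow> ('n \<Rightarrow> nat) \<Rightarrow> real^'n \<Rightarrow> real" where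
  "coord_prod G D x = (\<Prod>i\<in>UNIV. G i (D i) (x $ i))"

lemma has_derivative_coord_prod:
  fixes G :: "'n::finite \<Rightarrow> nat \<Rightarrow> real \<Rightarrow> real"
  assumes "\<And>i. deriv_seq UNIV (G i)"
  shows "(coord_prod G D has_derivative
    (\<lambda>h. \<Sum>i\<in>UNIV. h $ i * coord_prod G (D(i := Suc (D i))) x)) (at x)"
proof -
  have "((\<lambda>x. G i (D i) (x $ i)) has_derivative (\<lambda>h. G i (Suc (D i)) (x $ i) * h $ i)) (at x)" for i
    by (rule has_derivative_compose[OF bounded_linear_imp_has_derivative[OF bounded_linear_vec_nth]])
       (use deriv_seqD[OF assms UNIV_I] in \<open>simp add: has_field_derivative_def\<close>)
  then have "((\<lambda>x. \<Prod>i\<in>UNIV. G i (D i) (x $ i)) has_derivative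
      (\<lambda>h. \<Sum>i\<in>UNIV. G i (Suc (D i)) (x $ i) * h $ i * (\<Prod>j\<in>UNIV - {i}. G j (D j) (x $ j)))) (at x)"
    by (rule has_derivative_prod)
  moreover have "coord_prod G (D(i := Suc (D i))) x = G i (Suc (D i)) (x $ i) * (\<Prod>j\<in>UNIV - {i}. G j (D j) (x $ j))" for i
  proof -
    have "coord_prod G (D(i := Suc (D i))) x = G i (Suc (D i)) (x $ i) *
        (\<Prod>j\<in>UNIV - {i}. G j ((D(i := Suc (D i))) j) (x $ j))"
      by (simp add: coord_prod_def prod.remove[of UNIV i])
    also have "(\<Prod>j\<in>UNIV - {i}. G j ((D(i := Suc (D i))) j) (x $ j)) = (\<Prod>j\<in>UNIV - {i}. G j (D j) (x $ j))"
      by (rule prod.cong) auto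
    finally show ?thesis .
  qed
  ultimately show ?thesis
    by (simp add: coord_prod_def[abs_def] mult_ac)
qed

lemma partial_coord_prod:
  assumes "\<And>i. deriv_seq UNIV (G i)"
  shows "partial i (coord_prod G D) = coord_prod G (D(i := Suc (D i)))"
proof
  fix x
  show "partial i (coord_prod G D) x = coord_prod G (D(i := Suc (D i))) x"
    by (subst partial_eqI[OF has_derivative_coord_prod[OF assms]])
       (simp add: axis_def if_distrib[of "\<lambda>c. c * _"] cong: if_cong)
qed

text \<open>Each derivative raises one entry of the multi-index, so only the number of occurrences
  of each direction in \<open>I\<close> survives. Later reorderings of derivatives rest on
  this.\<close>

lemma partials_coord_prod:
  assumes "\<And>i. deriv_seq UNIV (G i)"
  shows "partials I (coord_prod G D) = coord_prod G (\<lambda>i. D i + count_list I i)"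
proof (induction I)
  case (Cons i I)
  have "(\<lambda>l. D l + count_list I l)(i := Suc (D i + count_list I i)) = (\<lambda>l. D l + count_list (i # I) l)"
    by auto
  then show ?case by (simp add: partials_Cons Cons partial_coord_prod[OF assms])
qed simp

lemma smooth_on_coord_prod:
  assumes "\<And>i. deriv_seq UNIV (G i)"
  shows "smooth_on S (coord_prod G D)"
  using has_derivative_coord_prod[of G, OF assms]
  by (auto simp: smooth_on_def partials_coord_prod[of G, OF assms] differentiable_def)

lemma coord_prod_support:
  fixes a b :: "real^'n::finite"
  assumes "\<And>i j t. t \<notin> {a $ i..b $ i} \<Longrightarrow> G i j t = 0" "x \<notin> cbox a b"
  shows "coord_prod G D x = 0"
proof -
  obtain i where "x $ i \<notin> {a $ i..b $ i}"
    using assms(2) by (auto simp: mem_box_cart)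
  then show ?thesis
    using assms(1) by (auto simp: coord_prod_def)
qed

lemma test_function_coord_prod:
  fixes a b :: "real^'n::finite"
  assumes "\<And>i. deriv_seq UNIV (G i)"
    and "\<And>i j t. t \<notin> {a $ i..b $ i} \<Longrightarrow> G i j t = 0" and "cbox a b \<subseteq> \<Omega>"
  shows "test_function \<Omega> (coord_prod G D)"
proof -
  have "closure {x. coord_prod G D x \<noteq> 0} \<subseteq> cbox a b"
    by (rule closure_minimal) (use coord_prod_support[of a b G, OF assms(2)] in auto)
  then show ?thesis
    unfolding test_function_def using assms(3)
    by (auto intro: smooth_on_coord_prod[OF assms(1)] closed_Int_compact simp: compact_eq_bounded_closed
        dest: bounded_subset[OF bounded_cbox])
qed

section \<open>A regularised distance on the unit ball\<close>

definition sqrt_seq :: "nat \<Rightarrow> real \<Rightarrow> real" where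
  "sqrt_seq j t = (\<Prod>i<j. 1 / 2 - real i) * t powr (1 / 2 - real j)"

lemma deriv_seq_sqrt: "deriv_seq {0<..} sqrt_seq"
  by (auto simp: deriv_seq_def sqrt_seq_def[abs_def] algebra_simps
      intro!: derivative_eq_intros)

lemma infdist_unit_sphere:
  fixes x :: "'a::euclidean_space"
  assumes "norm x \<le> 1"
  shows "infdist x (sphere 0 1) = 1 - norm x"
proof (rule antisym)
  obtain e :: 'a where e: "norm e = 1"
    using vector_choose_size[of 1] by auto
  define y where "y = (if x = 0 then e else x /\<^sub>R norm x)"
  have y: "norm y = 1" "x = norm x *\<^sub>R y" using e by (auto simp: y_def)
  have "dist x y = norm ((1 - norm x) *\<^sub>R y)"
    by (subst y(2)) (simp add: dist_norm algebra_simps norm_minus_commute)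
  then have "dist x y = 1 - norm x" using y(1) assms by simp
  then show "infdist x (sphere 0 1) \<le> 1 - norm x"
    using infdist_le[of y "sphere 0 1" x] y by simp
  have "sphere (0::'a) 1 \<noteq> {}" using e by auto
  moreover have "1 - norm x \<le> dist x z" if "norm z = 1" for z
    using norm_triangle_ineq2[of z x] that by (simp add: dist_norm norm_minus_commute)
  ultimately show "1 - norm x \<le> infdist x (sphere 0 1)"
    by (auto simp: infdist_def intro!: cINF_greatest)
qed

text \<open>This keeps the statement about all regularised distances from being vacuous. The
  distance \<open>1 - norm x\<close> fails to be smooth only at the origin, so the square under the
  root in \<open>sqrt ((norm x)\<^sup>2)\<close> is replaced by a smooth \<open>f\<close> that is
  positive everywhere and agrees with it for \<open>norm x \<ge> 1/2\<close>.\<close>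

lemma regularised_distance_unit_ball:
  "\<exists>d. regularised_distance (ball (0::real^'n::finite) 1) d"
proof -
  define f :: "real^'n \<Rightarrow> real" where "f x = (norm x)\<^sup>2 + exp_inv 1 0 (1/4 + (-1) * (norm x)\<^sup>2)" for x
  have f_pos: "f x > 0" for x
    by (auto simp: f_def exp_inv_0 add_nonneg_pos)
  have f_eq: "f x = (norm x)\<^sup>2" if "norm x \<ge> 1/2" for x
    using power_mono[OF that, of 2] by (simp add: f_def exp_inv_0 power2_eq_square)
  have f_less: "f x < 1" if "norm x < 1" for x
  proof (cases "norm x \<ge> 1/2")
    case True
    then show ?thesis using that by (simp add: f_eq abs_square_less_1)
  next
    case False
    then have *: "1/4 - (norm x)\<^sup>2 > 0"
      using power_strict_mono[of "norm x" "1/2" 2] by (simp add: power2_eq_square)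
    let ?t = "1/4 - (norm x)\<^sup>2"
    \<comment> \<open>Hence the correction \<open>exp (- 1 / ?t)\<close> is at most
      \<open>?t\<close>, and \<open>f x \<le> (norm x)\<^sup>2 + ?t = 1/4\<close>; this keeps
      \<open>1 - sqrt (f x)\<close> positive.\<close>
    have "1 / ?t \<le> exp (1 / ?t)" using exp_ge_add_one_self[of "1 / ?t"] by linarith
    then have "exp (- 1 / ?t) \<le> ?t"
      using * by (simp add: exp_minus field_simps)
    then show ?thesis using * by (simp add: f_def exp_inv_0)
  qed
  have "smooth_on UNIV f"
    unfolding f_def
    by (intro smooth_on_add smooth_on_norm_sq smooth_on_const smooth_on_mult
        smooth_on_comp[where T = UNIV and s = "exp_inv 1"] deriv_seqD[OF deriv_seq_exp_inv]) auto
  then have "smooth_on UNIV (\<lambda>x. 1 + (-1) * sqrt_seq 0 (f x))"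
    by (intro smooth_on_add smooth_on_const smooth_on_mult
        smooth_on_comp[where T = "{0<..}" and s = sqrt_seq] deriv_seqD[OF deriv_seq_sqrt])
       (auto simp: f_pos)
  then have "smooth_on (ball 0 1) (\<lambda>x. 1 - sqrt (f x))"
    using f_pos by (simp add: smooth_on_def sqrt_seq_def powr_half_sqrt less_imp_le)
  moreover have "1 - sqrt (f x) = infdist x (frontier (ball 0 1))"
    if "x \<in> ball 0 1" "infdist x (frontier (ball 0 1)) < 1/2" for x
  proof -
    have "norm x > 1/2" using that by (simp add: infdist_unit_sphere)
    then show ?thesis using that by (simp add: infdist_unit_sphere f_eq)
  qed
  ultimately show ?thesis
    unfolding regularised_distance_def using f_less
    by (intro exI[of _ "\<lambda>x. 1 - sqrt (f x)"] conjI exI[of _ "1/2"]) auto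
qed

section \<open>Weak derivatives\<close>

lemma borel_measurable_lebesgueI: "f \<in> borel_measurable borel \<Longrightarrow> f \<in> borel_measurable lebesgue"
  by (intro measurable_completion) simp

lemma integrable_lborel_compact_support:
  fixes f :: "'a::euclidean_space \<Rightarrow> real"
  assumes "continuous_on UNIV f" "compact K" "\<And>x. x \<notin> K \<Longrightarrow> f x = 0"
  shows "integrable lborel f"
proof -
  have "integrable lborel (\<lambda>x. indicator K x *\<^sub>R f x)"
    by (rule borel_integrable_compact[OF assms(2) continuous_on_subset[OF assms(1)]]) simp
  moreover have "(\<lambda>x. indicator K x *\<^sub>R f x) = f"
    using assms(3) by (auto simp: fun_eq_iff indicator_def)
  ultimately show ?thesis by simp
qed

lemma integral_lborel_translation:
  fixes f :: "'a::euclidean_space \<Rightarrow> real"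
  assumes "f \<in> borel_measurable borel"
  shows "(\<integral>x. f (c + x) \<partial>lborel) = (\<integral>x. f x \<partial>lborel)"
  using integral_distr[of "(+) c" lborel borel f] assms by (simp add: lborel_distr_plus)

lemma partial_line_derivative:
  assumes "F differentiable (at (x + t *\<^sub>R axis i 1))"
  shows "((\<lambda>t. F (x + t *\<^sub>R axis i 1)) has_real_derivative partial i F (x + t *\<^sub>R axis i 1)) (at t)"
proof -
  let ?y = "x + t *\<^sub>R axis i 1" and ?D = "frechet_derivative F (at (x + t *\<^sub>R axis i 1))"
  have F: "(F has_derivative ?D) (at ?y)"
    using assms by (simp add: frechet_derivative_works)
  have "((\<lambda>t. x + t *\<^sub>R axis i 1) has_derivative (\<lambda>h. h *\<^sub>R axis i 1)) (at t)"
    by (auto intro!: derivative_eq_intros)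
  from has_derivative_compose[OF this F]
  have "((\<lambda>t. F (x + t *\<^sub>R axis i 1)) has_derivative (\<lambda>h. ?D (h *\<^sub>R axis i 1))) (at t)" .
  moreover have "?D (h *\<^sub>R axis i 1) = partial i F ?y * h" for h
    using linear_scale[OF has_derivative_linear[OF F]] by (simp add: partial_def)
  ultimately show ?thesis
    by (simp add: has_field_derivative_def)
qed

text \<open>By translation invariance every difference quotient of \<open>F\<close> in direction
  \<open>i\<close> has integral 0. The quotients converge pointwise to \<open>partial i F\<close>;
  by the mean value theorem they are bounded by a bound of \<open>partial i F\<close>, and they live
  in one fixed ball, so dominated convergence applies.\<close>

lemma integral_partial_eq_0:
  fixes F :: "real^'n::finite \<Rightarrow> real"
  assumes diff: "\<And>x. F differentiable (at x)" and cont: "continuous_on UNIV (partial i F)"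
    and K: "compact K" "\<And>x. x \<notin> K \<Longrightarrow> F x = 0"
  shows "(\<integral>x. partial i F x \<partial>lborel) = 0"
proof -
  let ?e = "axis i 1 :: real^'n"
  have contF: "continuous_on UNIV F"
    by (simp add: continuous_on_eq_continuous_at diff differentiable_imp_continuous_within)
  have [measurable]: "F \<in> borel_measurable borel" "partial i F \<in> borel_measurable borel"
    by (rule borel_measurable_continuous_onI[OF contF], rule borel_measurable_continuous_onI[OF cont])
  have p0: "partial i F x = 0" if "x \<notin> K" for x
    using partial_cong[of "- K" x F "\<lambda>_. 0" i] that K compact_imp_closed[OF K(1)]
    by (simp add: open_Compl)
  obtain B where B: "\<And>x. \<bar>partial i F x\<bar> \<le> B" "B > 0"
  proof -
    have "bounded (partial i F ` K)"
      by (rule compact_imp_bounded[OF compact_continuous_image[OF continuous_on_subset[OF cont] K(1)]]) simp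
    then obtain B where "B > 0" "\<And>y. y \<in> partial i F ` K \<Longrightarrow> norm y \<le> B"
      by (auto simp: bounded_pos)
    then have "\<bar>partial i F x\<bar> \<le> B" for x
      using p0[of x] by (cases "x \<in> K") auto
    then show ?thesis using that \<open>B > 0\<close> by blast
  qed
  obtain R where R: "\<And>x. x \<in> K \<Longrightarrow> norm x \<le> R"
    using compact_imp_bounded[OF K(1)] by (auto simp: bounded_iff)
  \<comment> \<open>Steps of length at most 1 keep all the difference quotients supported in the
    ball of radius \<open>R + 1\<close>.\<close>
  define h where "h n = 1 / (real n + 1)" for n
  have h: "0 < h n" "h n \<le> 1" for n by (auto simp: h_def)
  define Q where "Q n x = (F (h n *\<^sub>R ?e + x) - F x) / h n" for n x
  have [measurable]: "Q n \<in> borel_measurable borel" for n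
    unfolding Q_def by measurable
  have intF: "integrable lborel F"
    by (rule integrable_lborel_compact_support[OF contF K])
  have Q0: "(\<integral>x. Q n x \<partial>lborel) = 0" for n
  proof -
    have "integrable lborel (\<lambda>x. F (h n *\<^sub>R ?e + x))"
      using intF integrable_distr_eq[of "(+) (h n *\<^sub>R ?e)" lborel borel F]
      by (simp add: lborel_distr_plus)
    then show ?thesis
      using intF by (simp add: Q_def integral_lborel_translation)
  qed
  have "(\<lambda>n. \<integral>x. Q n x \<partial>lborel) \<longlonglongrightarrow> (\<integral>x. partial i F x \<partial>lborel)"
  proof (rule integral_dominated_convergence)
    show "integrable lborel (\<lambda>x::real^'n. B * indicat_real (cball 0 (R + 1)) x)"
      by (intro integrable_mult_right integrable_real_indicator emeasure_lborel_cball_finite) simp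
    show "AE x in lborel. (\<lambda>n. Q n x) \<longlonglongrightarrow> partial i F x"
    proof (rule AE_I2)
      fix x
      have "((\<lambda>t. F (x + t *\<^sub>R ?e)) has_real_derivative partial i F (x + 0 *\<^sub>R ?e)) (at 0)"
        by (rule partial_line_derivative[OF diff])
      then have l: "((\<lambda>t. (F (x + t *\<^sub>R ?e) - F x) / t) \<longlongrightarrow> partial i F x) (at 0)"
        by (simp add: has_field_derivative_iff)
      have "h \<longlonglongrightarrow> 0" unfolding h_def by real_asymp
      then have "filterlim h (at 0) sequentially"
        using h by (auto simp: filterlim_at intro!: always_eventually less_imp_neq[symmetric])
      from filterlim_compose[OF l this] show "(\<lambda>n. Q n x) \<longlonglongrightarrow> partial i F x"
        by (simp add: Q_def add.commute)
    qed
    show "AE x in lborel. norm (Q n x) \<le> B * indicat_real (cball 0 (R + 1)) x" for n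
    proof (rule AE_I2)
      fix x
      show "norm (Q n x) \<le> B * indicat_real (cball 0 (R + 1)) x"
      proof (cases "norm x \<le> R + 1")
        case True
        obtain z where z: "F (x + h n *\<^sub>R ?e) - F (x + 0 *\<^sub>R ?e) = (h n - 0) * partial i F (x + z *\<^sub>R ?e)"
          using MVT2[of 0 "h n" "\<lambda>t. F (x + t *\<^sub>R ?e)" "\<lambda>t. partial i F (x + t *\<^sub>R ?e)"] h
            partial_line_derivative[OF diff] by blast
        then have "Q n x = partial i F (x + z *\<^sub>R ?e)"
          using h[of n] by (simp add: Q_def add.commute)
        then show ?thesis using B True by simp
      next
        case False
        have "norm x \<le> norm (h n *\<^sub>R ?e + x) + norm (h n *\<^sub>R ?e)"
          using norm_triangle_ineq4[of "h n *\<^sub>R ?e + x" "h n *\<^sub>R ?e"] by simp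
        then have "norm (h n *\<^sub>R ?e + x) > R"
          using False h[of n] by simp
        then have "F (h n *\<^sub>R ?e + x) = 0" "F x = 0"
          using R K(2) False by (meson not_le, smt (verit) R K(2))
        then show ?thesis by (simp add: Q_def False)
      qed
    qed
  qed auto
  then show ?thesis using Q0 by (simp add: LIMSEQ_const_iff)
qed

lemma smooth_on_continuous: "smooth_on UNIV f \<Longrightarrow> continuous_on UNIV (partials I f)"
  by (simp add: continuous_on_eq_continuous_at smooth_on_def differentiable_imp_continuous_within)

lemma smooth_on_partial: "smooth_on S f \<Longrightarrow> smooth_on S (partial i f)"
  unfolding smooth_on_def by (metis partials_snoc)

lemma smooth_on_partials: "smooth_on S f \<Longrightarrow> smooth_on S (partials I f)"
  by (simp add: smooth_on_def partials_def foldr_append[symmetric] del: foldr_append)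

lemma integration_by_parts:
  fixes f g :: "real^'n::finite \<Rightarrow> real"
  assumes f: "smooth_on UNIV f" and g: "smooth_on UNIV g"
    and K: "compact K" "\<And>x. x \<notin> K \<Longrightarrow> f x = 0"
  shows "(\<integral>x. f x * partial i g x \<partial>lborel) = - (\<integral>x. partial i f x * g x \<partial>lborel)"
proof -
  note diff = smooth_on_differentiable[OF _ UNIV_I, of _ "[]", simplified]
  note cont = smooth_on_continuous[of _ "[]", simplified]
  have fg: "smooth_on UNIV (\<lambda>x. f x * g x)"
    by (intro smooth_on_mult f g) simp
  have p: "partial i (\<lambda>x. f x * g x) = (\<lambda>x. partial i f x * g x + f x * partial i g x)"
    by (rule ext, rule partial_mult) (intro diff f g)+
  have "(\<integral>x. partial i (\<lambda>x. f x * g x) x \<partial>lborel) = 0"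
    by (rule integral_partial_eq_0[OF diff[OF fg] cont[OF smooth_on_partial[OF fg]] K(1)])
       (simp add: K(2))
  moreover have "integrable lborel (\<lambda>x. f x * partial i g x)"
    by (rule integrable_lborel_compact_support[OF _ K(1)])
       (intro continuous_on_mult cont f smooth_on_partial g, simp add: K(2))
  moreover have "partial i f x = 0" if "x \<notin> K" for x
    using partial_cong[of "- K" x f "\<lambda>_. 0" i] that K compact_imp_closed[OF K(1)]
    by (simp add: open_Compl)
  then have "integrable lborel (\<lambda>x. partial i f x * g x)"
    by (intro integrable_lborel_compact_support[OF _ K(1)])
       (intro continuous_on_mult cont f smooth_on_partial g, simp)
  ultimately show ?thesis by (simp add: p)
qed

section \<open>Classical derivatives as weak derivatives\<close>

lemma locally_integrable_continuous:
  assumes "continuous_on UNIV f"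
  shows "locally_integrable \<Omega> f"
  unfolding locally_integrable_def set_integrable_def
proof (intro allI impI)
  fix K assume K: "compact K \<and> K \<subseteq> \<Omega>"
  then have "integrable lborel (\<lambda>x. indicator K x *\<^sub>R f x)"
    by (intro borel_integrable_compact continuous_on_subset[OF assms]) auto
  then show "integrable lebesgue (\<lambda>x. indicator K x *\<^sub>R f x)"
    by (simp add: integrable_completion[OF borel_measurable_integrable])
qed

lemma set_lebesgue_integral_borel_support:
  fixes f :: "'a::euclidean_space \<Rightarrow> real"
  assumes "f \<in> borel_measurable borel" "\<And>x. x \<notin> \<Omega> \<Longrightarrow> f x = 0"
  shows "(LINT x:\<Omega>|lebesgue. f x) = (\<integral>x. f x \<partial>lborel)"
proof -
  have "(\<lambda>x. indicator \<Omega> x *\<^sub>R f x) = f"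
    using assms(2) by (auto simp: fun_eq_iff indicator_def)
  then show ?thesis
    using assms(1) by (simp add: set_lebesgue_integral_def integral_completion)
qed

text \<open>Derivatives are moved off the test function one at a time. Each one raises an entry of
  \<open>D\<close>, so the induction on \<open>I\<close> runs over all \<open>D\<close> at once; all
  functions involved keep their support in the same box.\<close>

lemma is_weak_partial_coord_prod:
  fixes a b :: "real^'n::finite"
  assumes G: "\<And>i. deriv_seq UNIV (G i)"
    and supp: "\<And>i j t. t \<notin> {a $ i..b $ i} \<Longrightarrow> G i j t = 0" and "cbox a b \<subseteq> \<Omega>"
  shows "is_weak_partial \<Omega> I (coord_prod G D) (partials I (coord_prod G D))"
proof -
  have sm: "smooth_on UNIV (coord_prod G D)" for D
    by (rule smooth_on_coord_prod[OF G])
  note cont = smooth_on_continuous[of _ "[]", simplified]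
  have z: "coord_prod G D x = 0" if "x \<notin> cbox a b" for D x
    by (rule coord_prod_support[of a b G, OF supp that])
  have *: "(\<integral>x. coord_prod G D x * partials I \<phi> x \<partial>lborel) = (- 1) ^ length I * (\<integral>x. partials I (coord_prod G D) x * \<phi> x \<partial>lborel)"
    if \<phi>: "smooth_on UNIV \<phi>" for \<phi>
  proof (induction I arbitrary: D)
    case (Cons i I)
    have "(\<integral>x. coord_prod G D x * partials (i # I) \<phi> x \<partial>lborel) = - (\<integral>x. partial i (coord_prod G D) x * partials I \<phi> x \<partial>lborel)"
      unfolding partials_Cons
      by (rule integration_by_parts[OF sm smooth_on_partials[OF \<phi>] compact_cbox]) (rule z)
    also have "\<dots> = - ((- 1) ^ length I * (\<integral>x. partials I (partial i (coord_prod G D)) x * \<phi> x \<partial>lborel))"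
      by (simp only: partial_coord_prod[of G, OF G] Cons.IH)
    \<comment> \<open>The outermost derivative of \<open>\<phi>\<close> arrives innermost on the
      product; the two orders are compared through their multi-indices.\<close>
    also have "partials I (partial i (coord_prod G D)) = partials (i # I) (coord_prod G D)"
      by (simp only: partial_coord_prod[of G, OF G] partials_coord_prod[of G, OF G]) (rule arg_cong[where f = "coord_prod G"], auto)
    finally show ?case by simp
  qed simp
  have "(LINT x:\<Omega>|lebesgue. coord_prod G D x * partials I \<phi> x) =
      (- 1) ^ length I * (LINT x:\<Omega>|lebesgue. partials I (coord_prod G D) x * \<phi> x)"
    if "test_function \<Omega> \<phi>" for \<phi>
  proof -
    have \<phi>: "smooth_on UNIV \<phi>" using that by (simp add: test_function_def)
    have z': "x \<notin> \<Omega> \<Longrightarrow> coord_prod G D x = 0" for x D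
      using z assms(3) by blast
    have 1: "(LINT x:\<Omega>|lebesgue. coord_prod G D x * partials I \<phi> x) = (\<integral>x. coord_prod G D x * partials I \<phi> x \<partial>lborel)"
      by (intro set_lebesgue_integral_borel_support borel_measurable_continuous_onI
          continuous_on_mult smooth_on_continuous sm \<phi> cont) (simp add: z')
    have 2: "(LINT x:\<Omega>|lebesgue. partials I (coord_prod G D) x * \<phi> x) = (\<integral>x. partials I (coord_prod G D) x * \<phi> x \<partial>lborel)"
      by (intro set_lebesgue_integral_borel_support borel_measurable_continuous_onI
          continuous_on_mult smooth_on_continuous sm \<phi> cont) (simp add: z' partials_coord_prod[of G, OF G])
    show ?thesis by (simp only: 1 2 *[OF \<phi>])
  qed
  then show ?thesis
    unfolding is_weak_partial_def
    by (auto intro!: locally_integrable_continuous cont sm smooth_on_partials)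
qed

text \<open>Products of bumps with parameter \<open>1 / (n + 1)\<close> are test functions with
  values between 0 and 1 that converge pointwise to the indicator of the open box. The dominating
  function is \<open>\<bar>v\<bar>\<close> on the closed box, which is compact in
  \<open>\<Omega>\<close>.\<close>

lemma integral_box_eq_0:
  fixes a b :: "real^'n::finite"
  assumes v: "locally_integrable \<Omega> v"
    and z: "\<And>\<phi>. test_function \<Omega> \<phi> \<Longrightarrow> (LINT x:\<Omega>|lebesgue. v x * \<phi> x) = 0"
    and ab: "cbox a b \<subseteq> \<Omega>"
  shows "(\<integral>x. indicator (box a b) x * v x \<partial>lebesgue) = 0"
proof -
  define \<phi> where "\<phi> n = coord_prod (\<lambda>i. bump (1 / (real n + 1)) (a $ i) (b $ i)) (\<lambda>_. 0)" for n
  have test: "test_function \<Omega> (\<phi> n)" for n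
    unfolding \<phi>_def by (rule test_function_coord_prod[OF _ _ ab]) (auto simp: deriv_seq_bump bump_eq_0)
  have \<phi>_meas: "\<phi> n \<in> borel_measurable lebesgue" for n
  proof -
    have "continuous_on UNIV (\<phi> n)"
      using smooth_on_continuous[of "\<phi> n" "[]"] test by (simp add: test_function_def)
    then have "\<phi> n \<in> borel_measurable borel"
      by (rule borel_measurable_continuous_onI)
    then show ?thesis by (simp add: borel_measurable_lebesgueI)
  qed
  have \<phi>_out: "\<phi> n x = 0" if "x \<notin> box a b" for n x
  proof -
    obtain i where "x $ i \<notin> {a $ i<..<b $ i}"
      using \<open>x \<notin> box a b\<close> by (auto simp: mem_box_cart)
    then have "bump (1 / (real n + 1)) (a $ i) (b $ i) 0 (x $ i) = 0"
      by (rule bump_eq_0)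
    then show ?thesis by (auto simp: \<phi>_def coord_prod_def)
  qed
  have \<phi>_in: "\<phi> n x = (\<Prod>i\<in>UNIV. exp (- (1 / (real n + 1)) / (x $ i - a $ i)) * exp (- (1 / (real n + 1)) / (b $ i - x $ i)))"
    if "x \<in> box a b" for n x
    using that by (simp add: \<phi>_def coord_prod_def bump_0 mem_box_cart)
  have \<phi>_le: "\<bar>\<phi> n x\<bar> \<le> 1" for n x
  proof (cases "x \<in> box a b")
    case True
    then have "a $ i < x $ i" "x $ i < b $ i" for i by (simp_all add: mem_box_cart)
    then have "exp (- (1 / (real n + 1)) / (x $ i - a $ i)) * exp (- (1 / (real n + 1)) / (b $ i - x $ i)) \<le> 1" for i
      by (intro mult_le_one) (auto simp: divide_nonneg_pos divide_nonpos_pos less_imp_le)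
    then have "\<phi> n x \<le> 1" "0 \<le> \<phi> n x"
      unfolding \<phi>_in[OF True] by (auto intro!: prod_le_1 prod_nonneg)
    then show ?thesis by simp
  qed (simp add: \<phi>_out)
  have \<phi>_lim: "(\<lambda>n. \<phi> n x) \<longlonglongrightarrow> indicator (box a b) x" for x
  proof (cases "x \<in> box a b")
    case True
    have "(\<lambda>n. exp (- (1 / (real n + 1)) / c)) \<longlonglongrightarrow> 1" for c
    proof -
      have "(\<lambda>n. exp (- (1 / (real n + 1)) * inverse c)) \<longlonglongrightarrow> exp (- 0 * inverse c)"
        by (intro tendsto_exp tendsto_mult_right tendsto_minus) real_asymp
      then show ?thesis by (simp add: divide_inverse)
    qed
    then have "(\<lambda>n. \<Prod>i\<in>(UNIV::'n set). exp (- (1 / (real n + 1)) / (x $ i - a $ i)) * exp (- (1 / (real n + 1)) / (b $ i - x $ i)))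
        \<longlonglongrightarrow> (\<Prod>i\<in>(UNIV::'n set). 1 * 1)"
      by (intro tendsto_prod tendsto_mult)
    then show ?thesis using True by (simp add: \<phi>_in)
  qed (simp add: \<phi>_out)
  have v_int: "integrable lebesgue (\<lambda>x. indicator (cbox a b) x * v x)"
    using v ab by (auto simp: locally_integrable_def set_integrable_def)
  have box_v_meas: "(\<lambda>x. indicator (box a b) x * v x) \<in> borel_measurable lebesgue"
  proof -
    have "(\<lambda>x. indicator (box a b) x * (indicator (cbox a b) x * v x)) \<in> borel_measurable lebesgue"
      by (intro borel_measurable_times borel_measurable_indicator borel_measurable_integrable[OF v_int]) simp
    moreover have "(\<lambda>x. indicator (box a b) x * (indicator (cbox a b) x * v x)) = (\<lambda>x. indicator (box a b) x * v x)"
      using box_subset_cbox[of a b] by (auto simp: fun_eq_iff indicator_def)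
    ultimately show ?thesis by simp
  qed
  have eq: "indicator \<Omega> x *\<^sub>R (v x * \<phi> n x) = (indicator (cbox a b) x * v x) * \<phi> n x" for n x
    using ab \<phi>_out[of x n] box_subset_cbox[of a b] by (auto simp: indicator_def)
  have "(\<lambda>n. \<integral>x. (indicator (cbox a b) x * v x) * \<phi> n x \<partial>lebesgue) \<longlonglongrightarrow>
      (\<integral>x. indicator (box a b) x * v x \<partial>lebesgue)"
  proof (rule integral_dominated_convergence)
    show "integrable lebesgue (\<lambda>x. norm (indicator (cbox a b) x * v x))"
      using v_int by (rule integrable_norm)
    show "AE x in lebesgue. (\<lambda>n. indicator (cbox a b) x * v x * \<phi> n x) \<longlonglongrightarrow> indicator (box a b) x * v x"
    proof (rule AE_I2)
      fix x
      have "(\<lambda>n. indicator (cbox a b) x * v x * \<phi> n x) \<longlonglongrightarrow> indicator (cbox a b) x * v x * indicator (box a b) x"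
        by (intro tendsto_mult_left \<phi>_lim)
      moreover have "indicator (cbox a b) x * v x * indicator (box a b) x = indicator (box a b) x * v x"
        using box_subset_cbox[of a b] by (auto simp: indicator_def)
      ultimately show "(\<lambda>n. indicator (cbox a b) x * v x * \<phi> n x) \<longlonglongrightarrow> indicator (box a b) x * v x"
        by simp
    qed
    show "AE x in lebesgue. norm (indicator (cbox a b) x * v x * \<phi> n x) \<le> norm (indicator (cbox a b) x * v x)" for n
      using \<phi>_le by (intro AE_I2) (simp add: abs_mult mult_left_le)
  qed (intro box_v_meas borel_measurable_times borel_measurable_integrable[OF v_int] \<phi>_meas)+
  moreover have "(\<integral>x. (indicator (cbox a b) x * v x) * \<phi> n x \<partial>lebesgue) = 0" for n
    using z[OF test[of n]] unfolding set_lebesgue_integral_def eq .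
  ultimately show ?thesis by (simp add: LIMSEQ_const_iff)
qed

text \<open>Open boxes form an intersection-stable generator of the Borel sets, so the vanishing of
  the integral spreads to all Borel sets by a Dynkin argument. It is run for a Borel function
  \<open>g\<close> equal to \<open>f\<close> almost everywhere.\<close>

lemma AE_eq_0_if_box_integrals_eq_0:
  fixes f :: "'a::euclidean_space \<Rightarrow> real"
  assumes f: "integrable lebesgue f" and supp: "\<And>x. x \<notin> box a b \<Longrightarrow> f x = 0"
    and z: "\<And>c d. (\<integral>x. indicator (box c d) x * f x \<partial>lebesgue) = 0"
  shows "AE x in lebesgue. f x = 0"
proof -
  obtain g where g: "g \<in> borel_measurable lborel" "AE x in lborel. f x = g x"
    using completion_ex_borel_measurable_real[OF borel_measurable_integrable[OF f]] by auto
  have fg: "AE x in lebesgue. f x = g x"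
    by (rule AE_completion[OF g(2)])
  have gm: "g \<in> borel_measurable lebesgue"
    using g(1) by (simp add: borel_measurable_lebesgueI)
  have "integrable lebesgue g"
    using integrable_cong_AE_imp[OF f gm] fg by simp
  then have gi: "integrable lborel g"
    using g(1) by (simp add: integrable_completion)
  have box: "(LINT x:box c d|lborel. g x) = 0" for c d
  proof -
    have "(LINT x:box c d|lborel. g x) = (\<integral>x. indicator (box c d) x * g x \<partial>lebesgue)"
      using g(1) by (simp add: set_lebesgue_integral_def integral_completion)
    also have "\<dots> = (\<integral>x. indicator (box c d) x * f x \<partial>lebesgue)"
    proof (rule integral_cong_AE)
      show "AE x in lebesgue. indicator (box c d) x * g x = indicator (box c d) x * f x"
        using fg by auto
    qed (intro borel_measurable_times borel_measurable_indicator gm borel_measurable_integrable[OF f]; simp)+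
    finally show ?thesis by (simp add: z)
  qed
  \<comment> \<open>Complements in the Dynkin argument require the integral over the whole space,
    which reduces to a box because \<open>f\<close> vanishes outside \<open>box a b\<close>.\<close>
  have total: "(\<integral>x. g x \<partial>lborel) = 0"
  proof -
    have "(\<integral>x. g x \<partial>lborel) = (LINT x:box a b|lborel. g x)"
      unfolding set_lebesgue_integral_def
      by (rule integral_cong_AE) (use g supp in \<open>auto simp: indicator_def elim!: AE_mp\<close>)
    then show ?thesis by (simp add: box)
  qed
  have sint: "set_integrable lborel A g" if "A \<in> sets borel" for A
    unfolding set_integrable_def using integrable_mult_indicator[OF _ gi] that by simp
  have "(LINT x:A|lborel. g x) = 0" if "A \<in> sets lborel" for A
  proof -
    let ?E = "range (\<lambda>(a, b). box a b::'a set)"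
    have b: "sets borel = sigma_sets UNIV ?E" by (simp add: borel_eq_box)
    have "Int_stable ?E"
      by (auto simp: Int_stable_def box_Int_box)
    moreover have "?E \<subseteq> Pow UNIV" "A \<in> sigma_sets UNIV ?E"
      using that b by auto
    ultimately show ?thesis
    proof (induction rule: sigma_sets_induct_disjoint)
      case (basic A)
      then show ?case by (auto simp: box)
    next
      case empty
      then show ?case by (simp add: set_lebesgue_integral_def)
    next
      case (compl A)
      then have A: "A \<in> sets borel" by (simp add: b)
      have "(LINT x:UNIV|lborel. g x) = (LINT x:A \<union> (UNIV - A)|lborel. g x)" by simp
      also have "\<dots> = (LINT x:A|lborel. g x) + (LINT x:UNIV - A|lborel. g x)"
        by (rule set_integral_Un) (use A in \<open>auto intro!: sint\<close>)
      finally show ?case using compl total by (simp add: set_lebesgue_integral_def)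
    next
      case (union A)
      have A: "A i \<in> sets borel" for i using union(2) b by auto
      have "(LINT x:(\<Union>i. A i)|lborel. g x) = (\<Sum>i. (LINT x:(A i)|lborel. g x))"
        by (rule lebesgue_integral_countable_add)
           (use A union(1) in \<open>auto simp: disjoint_family_on_def intro!: sint\<close>)
      then show ?case by (simp add: union)
    qed
  qed
  then have "AE x in lborel. g x = 0"
    by (rule sigma_finite_measure.density_zero[OF sigma_finite_lborel gi])
  then have "AE x in lebesgue. g x = 0"
    by (rule AE_completion)
  with fg show ?thesis by auto
qed

text \<open>The fundamental lemma of the calculus of variations. It is local:
  \<open>\<Omega>\<close> is a countable union of closed boxes, and on each of them the open box
  differs from the closed one by a null set.\<close>

lemma AE_eq_0_if_test_integrals_eq_0:
  fixes v :: "real^'n::finite \<Rightarrow> real"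
  assumes \<Omega>: "open \<Omega>" and v: "locally_integrable \<Omega> v"
    and z: "\<And>\<phi>. test_function \<Omega> \<phi> \<Longrightarrow> (LINT x:\<Omega>|lebesgue. v x * \<phi> x) = 0"
  shows "AE x in lebesgue. x \<in> \<Omega> \<longrightarrow> v x = 0"
proof -
  have cb: "AE x in lebesgue. x \<in> cbox a b \<longrightarrow> v x = 0" if ab: "cbox a b \<subseteq> \<Omega>" for a b
  proof -
    let ?f = "\<lambda>x. indicator (box a b) x * v x"
    have "set_integrable lebesgue (cbox a b) v"
      using v ab by (auto simp: locally_integrable_def)
    then have "set_integrable lebesgue (box a b) v"
      by (rule set_integrable_subset) (auto simp: box_subset_cbox)
    then have int: "integrable lebesgue ?f"
      by (simp add: set_integrable_def)
    have zero: "(\<integral>x. indicator (box c d) x * ?f x \<partial>lebesgue) = 0" for c d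
    proof -
      obtain p q where pq: "box c d \<inter> box a b = box p q"
        by (simp add: box_Int_box)
      have eq: "indicator (box c d) x * ?f x = indicator (box p q) x * v x" for x
        by (simp add: pq[symmetric] indicator_inter_arith)
      show ?thesis
      \<comment> \<open>An empty open box can have a nonempty, degenerate closed box, possibly not
        inside \<open>\<Omega>\<close>; only for a nonempty one is \<open>cbox p q\<close> its
        closure and hence contained in \<open>cbox a b\<close>.\<close>
      proof (cases "box p q = {}")
        case False
        then have "cbox p q = closure (box p q)" by (simp add: closure_box)
        also have "\<dots> \<subseteq> cbox a b"
          by (rule closure_minimal) (use pq box_subset_cbox[of a b] in auto)
        finally show ?thesis
          using integral_box_eq_0[OF v z, of p q] ab by (simp only: eq)
      qed (simp add: eq)
    qed
    have "AE x in lebesgue. ?f x = 0"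
      by (rule AE_eq_0_if_box_integrals_eq_0[where a = a and b = b, OF int _ zero]) simp
    moreover have "cbox a b - box a b \<in> null_sets lebesgue"
      using negligible_frontier_interval negligible_iff_null_sets by blast
    then have "AE x in lebesgue. x \<notin> cbox a b - box a b"
      by (rule AE_not_in)
    ultimately show ?thesis
      by eventually_elim (auto simp: indicator_def split: if_splits)
  qed
  obtain \<D> where D: "countable \<D>" "\<D> \<subseteq> Pow \<Omega>" "\<And>X. X \<in> \<D> \<Longrightarrow> \<exists>a b. X = cbox a b" "\<Union>\<D> = \<Omega>"
    using open_countable_Union_open_cbox[OF \<Omega>] by metis
  have "AE x in lebesgue. \<forall>X\<in>\<D>. x \<in> X \<longrightarrow> v x = 0"
    unfolding AE_ball_countable[OF D(1)]
  proof
    fix X assume X: "X \<in> \<D>"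
    then obtain a b where "X = cbox a b" using D(3) by blast
    with X D(2) show "AE x in lebesgue. x \<in> X \<longrightarrow> v x = 0" using cb[of a b] by auto
  qed
  then show ?thesis
    by eventually_elim (use D(4) in auto)
qed

lemma is_weak_partial_unique:
  assumes "open \<Omega>" "is_weak_partial \<Omega> I u v" "is_weak_partial \<Omega> I u w"
  shows "AE x in lebesgue. x \<in> \<Omega> \<longrightarrow> v x = w x"
proof -
  have li: "locally_integrable \<Omega> v" "locally_integrable \<Omega> w"
    using assms by (auto simp: is_weak_partial_def)
  \<comment> \<open>The integral of a non-integrable function is 0 by convention, so the integral of
    \<open>(v - w) * \<phi>\<close> splits only once both products are integrable. They are, because
    \<open>\<phi>\<close> is bounded with compact support in \<open>\<Omega>\<close>.\<close>
  have prod_int: "integrable lebesgue (\<lambda>x. indicator \<Omega> x *\<^sub>R (f x * \<phi> x))"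
    if \<phi>: "test_function \<Omega> \<phi>" and f: "locally_integrable \<Omega> f" for f \<phi>
  proof -
    let ?K = "closure {x. \<phi> x \<noteq> 0}"
    have K: "compact ?K" "?K \<subseteq> \<Omega>" using \<phi> by (auto simp: test_function_def)
    have cont: "continuous_on UNIV \<phi>"
      using smooth_on_continuous[of \<phi> "[]"] \<phi> by (simp add: test_function_def)
    have out: "\<phi> x = 0" if "x \<notin> ?K" for x using that closure_subset[of "{x. \<phi> x \<noteq> 0}"] by auto
    have "bounded (\<phi> ` ?K)"
      by (rule compact_imp_bounded[OF compact_continuous_image[OF continuous_on_subset[OF cont] K(1)]]) simp
    then obtain B where "\<And>y. y \<in> \<phi> ` ?K \<Longrightarrow> norm y \<le> B" "B > 0"
      by (auto simp: bounded_pos)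
    then have B: "norm (\<phi> x) \<le> B" for x using out[of x] by (cases "x \<in> ?K") auto
    have fK: "integrable lebesgue (\<lambda>x. indicator ?K x *\<^sub>R f x)"
      using f K by (auto simp: locally_integrable_def set_integrable_def)
    have \<phi>m: "\<phi> \<in> borel_measurable lebesgue"
      by (rule borel_measurable_lebesgueI) (rule borel_measurable_continuous_onI[OF cont])
    have "integrable lebesgue (\<lambda>x. \<phi> x * (indicator ?K x *\<^sub>R f x))"
    proof (rule Bochner_Integration.integrable_bound)
      show "integrable lebesgue (\<lambda>x. B * (indicator ?K x *\<^sub>R f x))"
        by (intro integrable_mult_right fK)
      show "(\<lambda>x. \<phi> x * (indicator ?K x *\<^sub>R f x)) \<in> borel_measurable lebesgue"
        by (intro borel_measurable_times \<phi>m borel_measurable_integrable[OF fK])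
      have "norm (\<phi> x) \<le> norm B" for x
        using B[of x] by simp
      then show "AE x in lebesgue. norm (\<phi> x * (indicator ?K x *\<^sub>R f x)) \<le> norm (B * (indicator ?K x *\<^sub>R f x))"
        by (intro AE_I2) (simp only: norm_mult mult_right_mono norm_ge_zero)
    qed
    moreover have "\<phi> x * (indicator ?K x *\<^sub>R f x) = indicator \<Omega> x *\<^sub>R (f x * \<phi> x)" for x
    proof (cases "x \<in> ?K")
      case True
      with K(2) have "x \<in> \<Omega>" by blast
      with True show ?thesis by simp
    next
      case False
      with out[OF False] show ?thesis by simp
    qed
    ultimately show ?thesis by (simp only:)
  qed
  have "AE x in lebesgue. x \<in> \<Omega> \<longrightarrow> v x - w x = 0"
  proof (rule AE_eq_0_if_test_integrals_eq_0[OF assms(1)])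
    show "locally_integrable \<Omega> (\<lambda>x. v x - w x)"
      using li unfolding locally_integrable_def by (blast intro: set_integral_diff(1))
    show "(LINT x:\<Omega>|lebesgue. (v x - w x) * \<phi> x) = 0" if \<phi>: "test_function \<Omega> \<phi>" for \<phi>
    proof -
      have "(LINT x:\<Omega>|lebesgue. v x * \<phi> x) = (LINT x:\<Omega>|lebesgue. w x * \<phi> x)"
        using assms(2,3) \<phi> by (auto simp: is_weak_partial_def)
      then have "(\<integral>x. indicator \<Omega> x *\<^sub>R (v x * \<phi> x) - indicator \<Omega> x *\<^sub>R (w x * \<phi> x) \<partial>lebesgue) = 0"
        unfolding set_lebesgue_integral_def
        by (subst Bochner_Integration.integral_diff[OF prod_int[OF \<phi> li(1)] prod_int[OF \<phi> li(2)]]) simp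
      then show ?thesis
        unfolding set_lebesgue_integral_def left_diff_distrib scaleR_diff_right .
    qed
  qed
  then show ?thesis by simp
qed

section \<open>Bounds on the norms\<close>

lemma ennpowr_le:
  assumes "t \<le> ennreal s" "0 \<le> s" "0 \<le> a"
  shows "ennpowr t a \<le> ennreal (s powr a)"
proof -
  have "t \<noteq> \<infinity>" using assms(1) by (auto simp: top_unique)
  moreover have "enn2real t \<le> s"
    using enn2real_leI[OF assms(2,1)] .
  ultimately show ?thesis
    using assms by (auto simp: ennpowr_def intro!: ennreal_leI powr_mono2)
qed

lemma ennpowr_ge:
  assumes "ennreal s \<le> t" "0 \<le> s" "0 \<le> a"
  shows "ennreal (s powr a) \<le> ennpowr t a"
proof (cases "t = \<infinity>")
  case False
  then obtain r where r: "t = ennreal r" "r \<ge> 0" by (cases t) auto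
  then have "s \<le> r" using assms by simp
  then show ?thesis
    using assms r by (auto simp: ennpowr_def intro!: ennreal_leI powr_mono2)
qed (simp add: ennpowr_def)

lemma weak_partial_is_weak_partial:
  assumes "is_weak_partial \<Omega> I u g" "I \<noteq> []"
  shows "is_weak_partial \<Omega> I u (weak_partial \<Omega> I u)"
  using assms someI[of "is_weak_partial \<Omega> I u" g] by (simp add: weak_partial_def)

lemma finite_lists_length_le_UNIV: "finite {I :: 'n::finite list. length I \<le> m}"
  using finite_lists_length_le[of "UNIV :: 'n set" m] by simp

lemma finite_lists_length_eq_UNIV: "finite {I :: 'n::finite list. length I = m}"
  using finite_lists_length_eq[of "UNIV :: 'n set" m] by simp

text \<open>By uniqueness the chosen weak derivatives equal \<open>g\<close> almost everywhere,
  simultaneously for the finitely many lists of a given length. The Euclidean length is bounded by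
  the sum of the absolute values; counting all lists of length at most \<open>m\<close> gives one
  factor for every order, and \<open>Suc m\<close> is the number of orders.\<close>

lemma sobolev_norm_le:
  fixes u :: "real^'n::finite \<Rightarrow> real"
  assumes \<Omega>: "open \<Omega>" and p: "p > 0"
    and g: "g [] = u" "\<And>I. length I \<le> m \<Longrightarrow> is_weak_partial \<Omega> I u (g I)"
    and B: "0 \<le> B" "\<And>I x. length I \<le> m \<Longrightarrow> x \<in> \<Omega> \<Longrightarrow> \<bar>g I x\<bar> \<le> B * indicator Q x"
    and Q: "Q \<in> lmeasurable" and W: "0 \<le> W" "\<And>x. x \<in> Q \<Longrightarrow> w x \<le> W"
  shows "sobolev_norm m p \<Omega> w u \<le> ennreal (real (Suc m) *
    ((real (card {I :: 'n list. length I \<le> m}) * B) powr p * W * measure lebesgue Q) powr (1 / p))"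
proof -
  let ?N = "real (card {I :: 'n list. length I \<le> m})"
  let ?c = "(?N * B) powr p * W"
  have wd: "weakly_differentiable m \<Omega> u"
    using g by (auto simp: weakly_differentiable_def)
  have "Lp_norm p \<Omega> w (grad_norm \<Omega> j u) \<le> ennreal ((?c * measure lebesgue Q) powr (1 / p))" if j: "j \<le> m" for j
  proof -
    have "AE x in lebesgue. \<forall>I\<in>{I. length I = j}. x \<in> \<Omega> \<longrightarrow> weak_partial \<Omega> I u x = g I x"
    proof (rule AE_finite_allI[OF finite_lists_length_eq_UNIV])
      fix I :: "'n list" assume I: "I \<in> {I. length I = j}"
      show "AE x in lebesgue. x \<in> \<Omega> \<longrightarrow> weak_partial \<Omega> I u x = g I x"
      \<comment> \<open>For the empty list \<open>weak_partial\<close> is \<open>u\<close> itself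
        and not a choice; equality there comes from \<open>g [] = u\<close>.\<close>
      proof (cases "I = []")
        case True
        then show ?thesis using g by (simp add: weak_partial_def)
      next
        case False
        have "is_weak_partial \<Omega> I u (g I)" using g(2) I j by simp
        from is_weak_partial_unique[OF \<Omega> weak_partial_is_weak_partial[OF this False] this]
        show ?thesis .
      qed
    qed
    then have "AE x in lebesgue. ennreal (\<bar>grad_norm \<Omega> j u x\<bar> powr p * w x) * indicator \<Omega> x \<le> ennreal ?c * indicator Q x"
    proof eventually_elim
      case (elim x)
      show ?case
      proof (cases "x \<in> \<Omega>")
        case True
        have gi: "grad_norm \<Omega> j u x = L2_set (\<lambda>I. g I x) {I. length I = j}"
          using elim True by (simp add: grad_norm_def L2_set_def)
        have "\<bar>grad_norm \<Omega> j u x\<bar> \<le> (\<Sum>I\<in>{I. length I = j}. \<bar>g I x\<bar>)"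
          unfolding gi using L2_set_le_sum_abs[of "\<lambda>I. g I x"] by (simp add: L2_set_nonneg)
        also have "\<dots> \<le> (\<Sum>I\<in>{I::'n list. length I = j}. B * indicator Q x)"
          by (rule sum_mono) (use B(2) True j in simp)
        also have "\<dots> = real (card {I::'n list. length I = j}) * (B * indicator Q x)" by simp
        also have "\<dots> \<le> ?N * (B * indicator Q x)"
          by (intro mult_right_mono)
             (use j B in \<open>auto intro!: card_mono finite_lists_length_le_UNIV simp: indicator_def\<close>)
        finally have le: "\<bar>grad_norm \<Omega> j u x\<bar> \<le> ?N * (B * indicator Q x)" .
        show ?thesis
        proof (cases "x \<in> Q")
          case True
          have "\<bar>grad_norm \<Omega> j u x\<bar> powr p \<le> (?N * B) powr p"
            by (rule powr_mono2) (use le p True in auto)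
          then have "\<bar>grad_norm \<Omega> j u x\<bar> powr p * w x \<le> ?c"
            using W(1) W(2)[OF True] by (meson mult_left_mono mult_right_mono order_trans powr_ge_zero)
          then show ?thesis using True by (auto simp: indicator_def intro: ennreal_leI)
        next
          case False
          then show ?thesis using le p by simp
        qed
      qed simp
    qed
    then have "(\<integral>\<^sup>+ x. ennreal (\<bar>grad_norm \<Omega> j u x\<bar> powr p * w x) \<partial>lebesgue_on \<Omega>) \<le> (\<integral>\<^sup>+ x. ennreal ?c * indicator Q x \<partial>lebesgue)"
      using \<Omega> by (subst nn_integral_restrict_space) (auto intro: nn_integral_mono_AE)
    also have "\<dots> = ennreal (?c * measure lebesgue Q)"
      by (subst nn_integral_cmult_indicator[OF fmeasurableD[OF Q]])
        (simp add: emeasure_eq_measure2[OF Q] ennreal_mult W(1))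
    finally show ?thesis
      unfolding Lp_norm_def using W(1) p by (intro ennpowr_le) auto
  qed
  then have "sobolev_norm m p \<Omega> w u \<le> (\<Sum>j\<le>m. ennreal ((?c * measure lebesgue Q) powr (1 / p)))"
    unfolding sobolev_norm_def if_P[OF wd] by (intro sum_mono) simp
  also have "\<dots> = ennreal (real (Suc m) * ((?c * measure lebesgue Q) powr (1 / p)))"
    by (simp add: ennreal_mult ennreal_of_nat_eq_real_of_nat del: of_nat_Suc)
  finally show ?thesis .
qed

text \<open>Below the threshold \<open>l\<close> the first summand suffices; above it
  \<open>s / l \<ge> 1\<close>, hence \<open>s / l \<le> (s / l) powr q\<close>.\<close>

lemma le_add_powr:
  fixes s l q :: real
  assumes "0 < l" "0 \<le> s" "1 \<le> q"
  shows "s \<le> l + l powr (1 - q) * s powr q"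
proof (cases "s \<le> l")
  case False
  then have "s / l \<le> (s / l) powr q"
    using assms powr_mono[of 1 q "s / l"] by simp
  then have "s \<le> l * (s powr q / l powr q)"
    using assms by (simp add: powr_divide field_simps)
  then show ?thesis
    using assms by (simp add: powr_diff)
qed (simp add: add_increasing2)

text \<open>Testing the weak derivative against \<open>\<psi>\<close> bounds its integral over \<open>Q\<close> from below without
  computing the derivatives of \<open>v\<close>; \<open>le_add_powr\<close> stands in for Hoelder's inequality.\<close>
lemma sobolev_norm_ge:
  fixes v :: "real^'n::finite \<Rightarrow> real"
  assumes \<Omega>: "open \<Omega>" and q: "1 \<le> q" and I: "I \<noteq> []" "length I = k"
    and \<psi>: "test_function \<Omega> \<psi>" "\<And>x. \<bar>\<psi> x\<bar> \<le> M * indicator Q x" and M: "0 < M"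
    and Q: "compact Q" "Q \<subseteq> \<Omega>" "0 < measure lebesgue Q"
    and w: "0 < w0" "\<And>x. x \<in> Q \<Longrightarrow> w0 \<le> w x"
    and L: "0 < L" "L \<le> \<bar>LINT x:\<Omega>|lebesgue. v x * partials I \<psi> x\<bar>"
  shows "ennreal ((w0 * (L / (2 * M * measure lebesgue Q)) powr q * measure lebesgue Q) powr (1 / q))
    \<le> sobolev_norm k q \<Omega> w v"
proof (cases "weakly_differentiable k \<Omega> v")
  case True
  \<comment> \<open>The pairing shows that the mean of \<open>\<bar>g\<bar>\<close> over
    \<open>Q\<close> is at least \<open>L / (M * ?V)\<close>, and \<open>l\<close> is half of that.
    Integrating \<open>le_add_powr\<close> over \<open>Q\<close> then loses only
    \<open>l * ?V\<close> out of \<open>2 * l * ?V\<close>, and what remains bounds the integral of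
    \<open>\<bar>g\<bar> powr q\<close> below by \<open>l powr q * ?V\<close>.\<close>
  let ?V = "measure lebesgue Q"
  define l where "l = L / (2 * M * ?V)"
  have l: "0 < l" using L M Q by (simp add: l_def)
  define g where "g = weak_partial \<Omega> I v"
  have g: "is_weak_partial \<Omega> I v g"
    using True I weak_partial_is_weak_partial unfolding weakly_differentiable_def g_def by blast
  have gQ: "integrable lebesgue (\<lambda>x. indicator Q x * g x)"
    using g Q unfolding is_weak_partial_def locally_integrable_def set_integrable_def by simp
  have Qm: "Q \<in> sets lebesgue" "emeasure lebesgue Q = ennreal ?V"
    using lmeasurable_compact[OF Q(1)] by (auto simp: emeasure_eq_measure2)
  have gm: "(\<lambda>x. indicator Q x * g x) \<in> borel_measurable lebesgue"
    using gQ by (rule borel_measurable_integrable)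
  have "L \<le> \<bar>LINT x:\<Omega>|lebesgue. g x * \<psi> x\<bar>"
    using g \<psi>(1) L by (auto simp: is_weak_partial_def abs_mult)
  also have "\<dots> \<le> (\<integral>x. \<bar>indicator \<Omega> x *\<^sub>R (g x * \<psi> x)\<bar> \<partial>lebesgue)"
    unfolding set_lebesgue_integral_def using integral_norm_bound[of lebesgue] by simp
  also have "\<dots> \<le> (\<integral>x. M * \<bar>indicator Q x * g x\<bar> \<partial>lebesgue)"
  proof (rule integral_mono_AE')
    show "integrable lebesgue (\<lambda>x. M * \<bar>indicator Q x * g x\<bar>)"
      by (intro integrable_mult_right integrable_abs gQ)
    have "\<bar>indicator \<Omega> x *\<^sub>R (g x * \<psi> x)\<bar> \<le> M * \<bar>indicator Q x * g x\<bar>" for x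
    proof -
      have "\<bar>indicator \<Omega> x *\<^sub>R (g x * \<psi> x)\<bar> \<le> \<bar>g x\<bar> * \<bar>\<psi> x\<bar>"
        by (auto simp: indicator_def abs_mult)
      also have "\<dots> \<le> \<bar>g x\<bar> * (M * indicator Q x)"
        by (intro mult_left_mono \<psi>) simp
      finally show ?thesis by (simp add: abs_mult mult_ac)
    qed
    then show "AE x in lebesgue. \<bar>indicator \<Omega> x *\<^sub>R (g x * \<psi> x)\<bar> \<le> M * \<bar>indicator Q x * g x\<bar>" by simp
  qed (use M in simp)
  also have "\<dots> = M * (\<integral>x. \<bar>indicator Q x * g x\<bar> \<partial>lebesgue)" by simp
  finally have "2 * l * ?V \<le> (\<integral>x. \<bar>indicator Q x * g x\<bar> \<partial>lebesgue)"
    using M Q by (simp add: l_def field_simps)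
  then have "ennreal (2 * l * ?V) \<le> ennreal (\<integral>x. \<bar>indicator Q x * g x\<bar> \<partial>lebesgue)"
    by (rule ennreal_leI)
  also have "\<dots> = (\<integral>\<^sup>+x. ennreal \<bar>indicator Q x * g x\<bar> \<partial>lebesgue)"
    by (rule nn_integral_eq_integral[symmetric]) (use gQ in auto)
  also have "\<dots> \<le> (\<integral>\<^sup>+x. ennreal l * indicator Q x + ennreal (l powr (1 - q)) * ennreal (\<bar>indicator Q x * g x\<bar> powr q) \<partial>lebesgue)"
  proof (rule nn_integral_mono)
    fix x
    have "\<bar>g x\<bar> \<le> l + l powr (1 - q) * \<bar>g x\<bar> powr q"
      using l q by (intro le_add_powr) auto
    then show "ennreal \<bar>indicator Q x * g x\<bar> \<le> ennreal l * indicator Q x + ennreal (l powr (1 - q)) * ennreal (\<bar>indicator Q x * g x\<bar> powr q)"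
      using l by (cases "x \<in> Q") (auto simp flip: ennreal_plus ennreal_mult intro!: ennreal_leI)
  qed
  also have "\<dots> = ennreal l * emeasure lebesgue Q + ennreal (l powr (1 - q)) * (\<integral>\<^sup>+x. ennreal (\<bar>indicator Q x * g x\<bar> powr q) \<partial>lebesgue)"
    (is "_ = _ + _ * ?J")
    using gm Qm(1) by (simp add: nn_integral_add nn_integral_cmult)
  finally have ineq: "ennreal (2 * l * ?V) \<le> ennreal (l * ?V) + ennreal (l powr (1 - q)) * ?J"
    using l by (simp add: Qm(2) ennreal_mult)
  have J: "ennreal (l powr q * ?V) \<le> ?J"
  proof (cases "?J = \<infinity>")
    case False
    then obtain y where y: "?J = ennreal y" "0 \<le> y" by (cases ?J) auto
    have "2 * l * ?V \<le> l * ?V + l powr (1 - q) * y"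
      using ineq y l by (simp flip: ennreal_plus ennreal_mult)
    then have "l * ?V \<le> l / l powr q * y" using l by (simp add: powr_diff)
    then have "l powr q * ?V \<le> y" using l by (simp add: field_simps)
    then show ?thesis using y by (simp add: ennreal_leI)
  qed simp
  have "ennreal (w0 * l powr q * ?V) = ennreal w0 * ennreal (l powr q * ?V)"
    using w(1) by (simp add: ennreal_mult' mult.assoc)
  also have "\<dots> \<le> ennreal w0 * ?J"
    by (intro mult_left_mono J) simp
  also have "\<dots> = (\<integral>\<^sup>+x. ennreal w0 * ennreal (\<bar>indicator Q x * g x\<bar> powr q) \<partial>lebesgue)"
    using gm by (simp add: nn_integral_cmult)
  also have "\<dots> \<le> (\<integral>\<^sup>+ x. ennreal (\<bar>grad_norm \<Omega> k v x\<bar> powr q * w x) * indicator \<Omega> x \<partial>lebesgue)"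
  proof (rule nn_integral_mono)
    fix x
    show "ennreal w0 * ennreal (\<bar>indicator Q x * g x\<bar> powr q) \<le> ennreal (\<bar>grad_norm \<Omega> k v x\<bar> powr q * w x) * indicator \<Omega> x"
    proof (cases "x \<in> Q")
      case True
      have "\<bar>g x\<bar> \<le> L2_set (\<lambda>I. weak_partial \<Omega> I v x) {I. length I = k}"
        using member_le_L2_set[OF finite_lists_length_eq_UNIV[of k], of I "\<lambda>I. \<bar>weak_partial \<Omega> I v x\<bar>"] I
        by (simp add: g_def L2_set_def)
      also have "\<dots> = \<bar>grad_norm \<Omega> k v x\<bar>"
        by (simp add: grad_norm_def L2_set_def sum_nonneg)
      finally have "\<bar>g x\<bar> powr q \<le> \<bar>grad_norm \<Omega> k v x\<bar> powr q"
        using q by (intro powr_mono2) auto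
      then have "\<bar>g x\<bar> powr q * w0 \<le> \<bar>grad_norm \<Omega> k v x\<bar> powr q * w x"
        using w(1) w(2)[OF True] by (intro mult_mono) auto
      then show ?thesis
        using True Q(2) w(1) by (auto simp: mult.commute simp flip: ennreal_mult intro!: ennreal_leI)
    qed (use q in simp)
  qed
  also have "\<dots> = (\<integral>\<^sup>+ x. ennreal (\<bar>grad_norm \<Omega> k v x\<bar> powr q * w x) \<partial>lebesgue_on \<Omega>)"
    using \<Omega> by (subst nn_integral_restrict_space) auto
  finally have "ennreal ((w0 * l powr q * ?V) powr (1 / q)) \<le> Lp_norm q \<Omega> w (grad_norm \<Omega> k v)"
    unfolding Lp_norm_def using w(1) q by (intro ennpowr_ge) auto
  also have "\<dots> \<le> (\<Sum>j\<le>k. Lp_norm q \<Omega> w (grad_norm \<Omega> j v))"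
    by (rule member_le_sum) auto
  finally show ?thesis using True by (simp add: sobolev_norm_def l_def)
\<comment> \<open>If \<open>v\<close> is not weakly differentiable, its norm is infinite and the
  bound is trivial.\<close>
qed (simp add: sobolev_norm_def)

section \<open>Bounds for the bump in one variable\<close>

lemma bump_continuous: "c > 0 \<Longrightarrow> isCont (bump c a b j) t"
  by (rule DERIV_isCont, rule deriv_seqD[OF deriv_seq_bump UNIV_I])

lemma bump_bounded:
  assumes "c > 0"
  shows "\<exists>M\<ge>1. \<forall>j\<le>J. \<forall>t. \<bar>bump c a b j t\<bar> \<le> M"
proof -
  have "\<exists>B. \<forall>t. \<bar>bump c a b j t\<bar> \<le> B" for j
  proof -
    have "bounded (bump c a b j ` {a..b})"
      using bump_continuous[OF assms]
      by (intro compact_imp_bounded compact_continuous_image continuous_at_imp_continuous_on) auto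
    then obtain B where B: "B > 0" "\<And>y. y \<in> bump c a b j ` {a..b} \<Longrightarrow> norm y \<le> B"
      by (auto simp: bounded_pos)
    have "\<bar>bump c a b j t\<bar> \<le> B" for t
      using B bump_eq_0[of t a b c j] by (cases "t \<in> {a..b}") auto
    then show ?thesis by blast
  qed
  then obtain B where B: "\<And>j t. \<bar>bump c a b j t\<bar> \<le> B j" by metis
  have B0: "0 \<le> B j" for j using B[of j 0] by linarith
  have "\<bar>bump c a b j t\<bar> \<le> 1 + (\<Sum>j\<le>J. B j)" if "j \<le> J" for j t
  proof -
    have "B j \<le> (\<Sum>j\<le>J. B j)" using that B0 by (intro member_le_sum) auto
    then show ?thesis using B[where j = j and t = t] by linarith
  qed
  moreover have "1 \<le> 1 + (\<Sum>j\<le>J. B j)" using B0 by (simp add: sum_nonneg)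
  ultimately show ?thesis by blast
qed

text \<open>If a derivative vanished identically, the preceding one would be constant, hence 0
  because it vanishes at \<open>b\<close>. Descending in this way reaches the bump itself, which is
  positive at the midpoint.\<close>

lemma bump_deriv_nonzero:
  assumes "c > 0" "a < b"
  shows "\<exists>t\<in>{a<..<b}. bump c a b k t \<noteq> 0"
proof (rule ccontr)
  assume "\<not> ?thesis"
  then have "\<forall>t. bump c a b k t = 0" using bump_eq_0 by blast
  then have "\<forall>t. bump c a b 0 t = 0"
  proof (induction k)
    case (Suc k)
    have "\<forall>t. (bump c a b k has_real_derivative 0) (at t)"
      using deriv_seqD[OF deriv_seq_bump[OF assms(1)], of _ a b k] Suc.prems by simp
    then have "bump c a b k t = bump c a b k b" for t
      by (rule DERIV_isconst_all)
    then have "\<forall>t. bump c a b k t = 0" by (simp add: bump_eq_0)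
    then show ?case by (rule Suc.IH)
  qed
  from spec[OF this, of "(a + b) / 2"] show False
    using assms by (simp add: bump_0)
qed

text \<open>In a \<open>k\<close>-th derivative of a product bump along one axis, one factor is a
  \<open>k\<close>-th derivative and all others are undifferentiated. One interval bounding both
  kinds from below therefore yields a subcube.\<close>

lemma bump_lower_bound:
  assumes "c > 0" "a < b"
  obtains \<alpha> \<beta> \<kappa> where "a \<le> \<alpha>" "\<alpha> < \<beta>" "\<beta> \<le> b" "\<kappa> > 0"
    "\<And>t. t \<in> {\<alpha>..\<beta>} \<Longrightarrow> \<kappa> \<le> \<bar>bump c a b 0 t\<bar> \<and> \<kappa> \<le> \<bar>bump c a b k t\<bar>"
proof -
  obtain t0 where t0: "t0 \<in> {a<..<b}" "bump c a b k t0 \<noteq> 0"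
    using bump_deriv_nonzero[OF assms] by blast
  define \<kappa> where "\<kappa> = min \<bar>bump c a b 0 t0\<bar> \<bar>bump c a b k t0\<bar> / 2"
  have \<kappa>: "\<kappa> > 0" using t0 by (simp add: \<kappa>_def bump_0)
  have lt: "\<kappa> < \<bar>bump c a b 0 t0\<bar>" "\<kappa> < \<bar>bump c a b k t0\<bar>"
    using \<kappa> by (auto simp: \<kappa>_def min_def split: if_splits)
  have lim: "((\<lambda>t. \<bar>bump c a b j t\<bar>) \<longlongrightarrow> \<bar>bump c a b j t0\<bar>) (nhds t0)" for j
    using bump_continuous[OF assms(1)] by (intro tendsto_rabs) (simp add: isCont_def tendsto_at_iff_tendsto_nhds)
  have "\<forall>\<^sub>F t in nhds t0. \<kappa> < \<bar>bump c a b 0 t\<bar> \<and> \<kappa> < \<bar>bump c a b k t\<bar> \<and> t \<in> {a<..<b}"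
    using t0 by (intro eventually_conj order_tendstoD(1)[OF lim lt(1)] order_tendstoD(1)[OF lim lt(2)]
        eventually_nhds_in_open) auto
  then obtain e where e: "e > 0" "\<And>t. dist t t0 < e \<Longrightarrow> \<kappa> < \<bar>bump c a b 0 t\<bar> \<and> \<kappa> < \<bar>bump c a b k t\<bar> \<and> t \<in> {a<..<b}"
    by (auto simp: eventually_nhds_metric)
  have e': "\<kappa> < \<bar>bump c a b 0 t\<bar> \<and> \<kappa> < \<bar>bump c a b k t\<bar> \<and> t \<in> {a<..<b}" if "t \<in> {t0 - e/2..t0 + e/2}" for t
    using that e(1) by (intro e(2)) (auto simp: dist_real_def abs_le_iff)
  show ?thesis
    by (rule that[of "t0 - e/2" "t0 + e/2" \<kappa>])
       (use e(1) e'[of "t0 - e/2"] e'[of "t0 + e/2"] e' \<kappa> in \<open>auto intro: less_imp_le\<close>)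
qed

section \<open>Bumps near the boundary\<close>

text \<open>Two offsets instead of a radius, because the subcube carrying the lower bound need not
  be centred at \<open>z\<close>.\<close>

definition cube :: "real^'n::finite \<Rightarrow> real \<Rightarrow> real \<Rightarrow> (real^'n) set" where
  "cube z a b = cbox (\<chi> i. z $ i + a) (\<chi> i. z $ i + b)"

lemma mem_cube: "x \<in> cube z a b \<longleftrightarrow> (\<forall>i. x $ i - z $ i \<in> {a..b})"
  by (auto simp: cube_def mem_box_cart algebra_simps)

lemma measure_cube: "a \<le> b \<Longrightarrow> measure lebesgue (cube (z::real^'n::finite) a b) = (b - a) ^ CARD('n)"
  unfolding cube_def by (subst measure_completion, simp) (simp add: content_cbox_if_cart interval_eq_empty_cart)

lemma compact_cube: "compact (cube z a b)"
  by (simp add: cube_def)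

text \<open>The \<open>j\<close>-th derivative of the bump at \<open>(t - z $ i) / e\<close>, with
  the argument spelled out in the form \<open>a * t + b\<close> of \<open>deriv_seq_affine\<close>.
  Every derivative costs a factor \<open>1 / e\<close>.\<close>

definition scaled_bump :: "real \<Rightarrow> real^'n::finite \<Rightarrow> 'n \<Rightarrow> nat \<Rightarrow> real \<Rightarrow> real" where
  "scaled_bump e z i j t = (1 / e) ^ j * bump 1 (- 1) 1 j (1 / e * t + (- z $ i / e))"

lemma deriv_seq_scaled_bump: "deriv_seq UNIV (scaled_bump e z i)"
  unfolding scaled_bump_def[abs_def] by (intro deriv_seq_affine deriv_seq_bump) simp

lemma scaled_bump_eq_0:
  assumes "e > 0" "t \<notin> {z $ i + - e..z $ i + e}"
  shows "scaled_bump e z i j t = 0"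
proof -
  have "1 / e * t + (- z $ i / e) = (t - z $ i) / e" by (simp add: diff_divide_distrib)
  moreover have "(t - z $ i) / e \<notin> {- 1<..<1}"
    using assms by (auto simp: field_simps)
  then have "bump 1 (- 1) 1 j ((t - z $ i) / e) = 0" by (rule bump_eq_0)
  ultimately show ?thesis by (simp only: scaled_bump_def mult_zero_right)
qed

lemma test_function_scaled_bump:
  "e > 0 \<Longrightarrow> cube z (- e) e \<subseteq> \<Omega> \<Longrightarrow> test_function \<Omega> (coord_prod (scaled_bump e z) D)"
  unfolding cube_def
  by (rule test_function_coord_prod[OF deriv_seq_scaled_bump]) (auto intro!: scaled_bump_eq_0)

lemma is_weak_partial_scaled_bump:
  "e > 0 \<Longrightarrow> cube z (- e) e \<subseteq> \<Omega> \<Longrightarrow>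
    is_weak_partial \<Omega> I (coord_prod (scaled_bump e z) D) (partials I (coord_prod (scaled_bump e z) D))"
  unfolding cube_def
  by (rule is_weak_partial_coord_prod[OF deriv_seq_scaled_bump]) (auto intro!: scaled_bump_eq_0)

lemma coord_prod_scaled_bump_eq_0:
  "e > 0 \<Longrightarrow> x \<notin> cube z (- e) e \<Longrightarrow> coord_prod (scaled_bump e z) D x = 0"
  unfolding cube_def
  by (rule coord_prod_support[where a = "\<chi> i. z $ i + - e" and b = "\<chi> i. z $ i + e"])
     (auto intro!: scaled_bump_eq_0)

lemma abs_coord_prod_scaled_bump_le:
  fixes z :: "real^'n::finite"
  assumes e: "e > 0" and M: "\<And>i t. \<bar>bump 1 (- 1) 1 (D i) t\<bar> \<le> M"
  shows "\<bar>coord_prod (scaled_bump e z) D x\<bar> \<le> (1 / e) ^ sum D UNIV * M ^ CARD('n)"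
proof -
  have "\<bar>coord_prod (scaled_bump e z) D x\<bar> = (\<Prod>i\<in>UNIV. (1 / e) ^ D i * \<bar>bump 1 (- 1) 1 (D i) (1 / e * x $ i + (- z $ i / e))\<bar>)"
    using e by (simp add: coord_prod_def scaled_bump_def abs_prod abs_mult)
  also have "\<dots> \<le> (\<Prod>i\<in>(UNIV :: 'n set). (1 / e) ^ D i * M)"
    using e by (intro prod_mono conjI mult_left_mono M) auto
  also have "\<dots> = (1 / e) ^ sum D UNIV * M ^ CARD('n)"
    by (simp add: prod.distrib power_sum)
  finally show ?thesis .
qed

lemma abs_coord_prod_scaled_bump_ge:
  fixes z :: "real^'n::finite"
  assumes e: "e > 0" and "\<kappa> > 0" and x: "x \<in> cube z (\<alpha> * e) (\<beta> * e)"
    and \<kappa>: "\<And>i t. t \<in> {\<alpha>..\<beta>} \<Longrightarrow> \<kappa> \<le> \<bar>bump 1 (- 1) 1 (D i) t\<bar>"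
  shows "(1 / e) ^ sum D UNIV * \<kappa> ^ CARD('n) \<le> \<bar>coord_prod (scaled_bump e z) D x\<bar>"
proof -
  have t: "1 / e * x $ i + (- z $ i / e) \<in> {\<alpha>..\<beta>}" for i
    using x e by (auto simp: mem_cube field_simps)
  have "(1 / e) ^ sum D UNIV * \<kappa> ^ CARD('n) = (\<Prod>i\<in>(UNIV :: 'n set). (1 / e) ^ D i * \<kappa>)"
    by (simp add: prod.distrib power_sum)
  also have "\<dots> \<le> (\<Prod>i\<in>UNIV. (1 / e) ^ D i * \<bar>bump 1 (- 1) 1 (D i) (1 / e * x $ i + (- z $ i / e))\<bar>)"
    using e assms(2) by (intro prod_mono conjI mult_left_mono \<kappa> t) auto
  also have "\<dots> = \<bar>coord_prod (scaled_bump e z) D x\<bar>"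
    using e by (simp add: coord_prod_def scaled_bump_def abs_prod abs_mult)
  finally show ?thesis .
qed

lemma sobolev_norm_zero:
  assumes "open \<Omega>" "p > 0"
  shows "sobolev_norm m p \<Omega> w (\<lambda>_. 0) = 0"
proof -
  have "is_weak_partial \<Omega> I (\<lambda>_. 0) (\<lambda>_. 0)" for I
    by (simp add: is_weak_partial_def locally_integrable_continuous set_lebesgue_integral_def)
  then show ?thesis
    using sobolev_norm_le[OF assms, of "\<lambda>_ _. 0" "\<lambda>_. 0" m 0 "{}" 0 w] by simp
qed

lemma test_function_in_sobolev_space0:
  assumes "open \<Omega>" "p > 0" "test_function \<Omega> u" "sobolev_norm m p \<Omega> w u < \<infinity>"
  shows "u \<in> sobolev_space0 m p \<Omega> w"
  using assms unfolding sobolev_space0_def sobolev_space_def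
  by (auto intro!: exI[of _ u] simp: sobolev_norm_zero)

text \<open>The centre has depth \<open>(N + 1) * e\<close>, and a point of the cube is at most
  \<open>N * e\<close> away from it, bounding the Euclidean norm by the sum of the coordinates. The
  depth thus stays between \<open>e\<close> and \<open>(2 * N + 1) * e\<close>.\<close>

lemma cube_near_sphere:
  fixes e :: real and i0 :: "'n::finite"
  defines "N \<equiv> real CARD('n)"
  assumes e: "0 < e" "(N + 1) * e \<le> 1" and x: "x \<in> cube ((1 - (N + 1) * e) *\<^sub>R axis i0 1) (- e) e"
  shows "e \<le> 1 - norm x" "1 - norm x \<le> (2 * N + 1) * e"
proof -
  let ?z = "(1 - (N + 1) * e) *\<^sub>R axis i0 1 :: real^'n"
  have "norm (x - ?z) \<le> (\<Sum>i\<in>UNIV. \<bar>(x - ?z) $ i\<bar>)"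
    by (rule norm_le_l1_cart)
  also have "\<dots> \<le> (\<Sum>i\<in>(UNIV :: 'n set). e)"
  proof (rule sum_mono)
    fix i
    have "- e \<le> (x - ?z) $ i \<and> (x - ?z) $ i \<le> e"
      using x[unfolded mem_cube, rule_format, of i]
      by (simp only: vector_minus_component atLeastAtMost_iff)
    then show "\<bar>(x - ?z) $ i\<bar> \<le> e" by linarith
  qed
  finally have "norm (x - ?z) \<le> N * e" by (simp add: N_def)
  moreover have "norm ?z = 1 - (N + 1) * e" using e by simp
  ultimately show "e \<le> 1 - norm x" "1 - norm x \<le> (2 * N + 1) * e"
    using norm_triangle_ineq2[of x ?z] norm_triangle_ineq2[of ?z x]
    by (simp_all add: norm_minus_commute algebra_simps)
qed

lemma count_list_replicate: "count_list (replicate k a) x = (if x = a then k else 0)"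
  by (induction k) auto

lemma sum_count_list: "sum (count_list I) (UNIV :: 'n::finite set) = length I"
  by (rule sum_count_set) auto

lemma powr_monomial:
  fixes e :: real
  assumes "0 < e" "0 \<le> a"
  shows "(a * e powr x) powr y = a powr y * e powr (x * y)"
  using assms by (simp add: powr_mult powr_powr)

text \<open>Taking \<open>u = \<partial>\<^sup>I\<psi>\<close> makes the integral of \<open>u / d\<^sup>m\<^sup>-\<^sup>k\<close> against \<open>\<partial>\<^sup>I\<psi>\<close> positive.\<close>
lemma boundary_bump_norms:
  fixes d :: "real^'n::finite \<Rightarrow> real" and m k :: nat and p q r :: real
  defines "\<Omega> \<equiv> ball (0 :: real^'n) 1"
  assumes d: "regularised_distance \<Omega> d" and k: "1 \<le> k" "k \<le> m" and p: "1 \<le> p" and q: "1 \<le> q"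
  shows "\<exists>c C. 0 < c \<and> (\<forall>\<^sub>F e in at_right 0. \<exists>u\<in>sobolev_space0 m p \<Omega> (\<lambda>x. d x powr (p - 1)).
      sobolev_norm m p \<Omega> (\<lambda>x. d x powr (p - 1)) u
        \<le> ennreal (C * e powr ((real CARD('n) + p - 1) / p - real (m + k))) \<and>
      ennreal (c * e powr ((real CARD('n) + r) / q - real (m + k)))
        \<le> sobolev_norm k q \<Omega> (\<lambda>x. d x powr r) (\<lambda>x. u x / d x ^ (m - k)))"
proof -
  let ?n = "CARD('n)"
  define N where "N = real ?n"
  define A where "A = 2 * N + 1"
  have N: "1 \<le> N" by (simp add: N_def Suc_leI)
  have A: "1 \<le> A" using N by (simp add: A_def)
  obtain e1 where e1: "e1 > 0" "\<And>x. x \<in> \<Omega> \<Longrightarrow> infdist x (frontier \<Omega>) < e1 \<Longrightarrow> d x = infdist x (frontier \<Omega>)"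
    and dpos: "\<And>x. x \<in> \<Omega> \<Longrightarrow> 0 < d x" and dsm: "smooth_on \<Omega> d"
    using d by (auto simp: regularised_distance_def)
  \<comment> \<open>\<open>u\<close> is itself a derivative of order \<open>k\<close> and is
    differentiated up to \<open>m\<close> more times, so orders up to \<open>m + k\<close>
    occur.\<close>
  obtain M where M: "M \<ge> 1" "\<And>j t. j \<le> m + k \<Longrightarrow> \<bar>bump 1 (- 1) 1 j t\<bar> \<le> M"
    using bump_bounded[of 1 "m + k" "- 1" 1] by auto
  obtain \<alpha> \<beta> \<kappa> where \<alpha>\<beta>: "- 1 \<le> \<alpha>" "\<alpha> < \<beta>" "\<beta> \<le> 1" and \<kappa>: "\<kappa> > 0"
    "\<And>t. t \<in> {\<alpha>..\<beta>} \<Longrightarrow> \<kappa> \<le> \<bar>bump 1 (- 1) 1 0 t\<bar> \<and> \<kappa> \<le> \<bar>bump 1 (- 1) 1 k t\<bar>"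
    using bump_lower_bound[of 1 "- 1" 1 k] by auto
  obtain i0 :: 'n where True by simp
  define I where "I = replicate k i0"
  \<comment> \<open>On the cube \<open>e \<le> d x \<le> A * e\<close>; the minimum covers both
    signs of \<open>r\<close>, since \<open>d x powr r\<close> is at least \<open>e powr r\<close>
    for \<open>r \<ge> 0\<close> and at least \<open>(A * e) powr r\<close> for
    \<open>r < 0\<close>.\<close>
  define cr where "cr = min 1 (A powr r)"
  \<comment> \<open>What is left of the quotient \<open>L / (2 * M * measure lebesgue Q)\<close> of
    \<open>sobolev_norm_ge\<close> after all powers of \<open>e\<close> are taken out.\<close>
  define c1 where "c1 = (\<kappa> ^ ?n)\<^sup>2 * (\<beta> - \<alpha>) ^ ?n / (A ^ (m - k) * 2 * M ^ ?n * 2 ^ ?n)"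
  define c where "c = (cr * c1 powr q * 2 ^ ?n) powr (1 / q)"
  define L where "L = real (card {I :: 'n list. length I \<le> m})"
  \<comment> \<open>The bound of \<open>sobolev_norm_le\<close> without its powers of
    \<open>e\<close>: \<open>A powr (p - 1)\<close> stems from the weight and \<open>2 ^ ?n\<close>
    from the volume \<open>(2 * e) ^ ?n\<close> of the cube.\<close>
  define C where "C = real (Suc m) * ((L * M ^ ?n) powr p * A powr (p - 1) * 2 ^ ?n) powr (1 / p)"
  have "0 < cr" using A by (simp add: cr_def min_def)
  moreover have "0 < c1" using A \<kappa>(1) \<alpha>\<beta> M(1) by (simp add: c1_def)
  ultimately have cpos: "0 < cr" "0 < c1" "0 < c" by (auto simp: c_def)
  have main: "\<exists>u\<in>sobolev_space0 m p \<Omega> (\<lambda>x. d x powr (p - 1)).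
      sobolev_norm m p \<Omega> (\<lambda>x. d x powr (p - 1)) u
        \<le> ennreal (C * e powr ((N + p - 1) / p - real (m + k))) \<and>
      ennreal (c * e powr ((N + r) / q - real (m + k)))
        \<le> sobolev_norm k q \<Omega> (\<lambda>x. d x powr r) (\<lambda>x. u x / d x ^ (m - k))"
    if e: "0 < e" "(N + 1) * e \<le> 1" "A * e < e1" for e
  proof -
    define z where "z = (1 - (N + 1) * e) *\<^sub>R (axis i0 1 :: real^'n)"
    define Q where "Q = cube z (- e) e"
    define G where "G = scaled_bump e z"
    define \<psi> where "\<psi> = coord_prod G (\<lambda>_. 0)"
    define u where "u = partials I \<psi>"
    have e_le_1: "e \<le> 1"
      using e N by (smt (verit) mult_le_cancel_right1 mult_less_0_iff)
    have near: "e \<le> 1 - norm x" "1 - norm x \<le> A * e" if "x \<in> Q" for x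
      using cube_near_sphere[of e x i0] that e by (auto simp: N_def A_def Q_def z_def)
    have Q\<Omega>: "Q \<subseteq> \<Omega>" using near e by (force simp: \<Omega>_def)
    have dQ: "e \<le> d x" "d x \<le> A * e" if "x \<in> Q" for x
    proof -
      have "infdist x (frontier \<Omega>) = 1 - norm x"
        using near(1)[OF that] e by (simp add: \<Omega>_def infdist_unit_sphere)
      then have "d x = 1 - norm x"
        using e1(2)[of x] near(2)[OF that] that Q\<Omega> e by auto
      then show "e \<le> d x" "d x \<le> A * e" using near[OF that] by auto
    qed
    have \<Omega>: "open \<Omega>" by (simp add: \<Omega>_def)
    have compQ: "compact Q" by (simp add: Q_def compact_cube)
    have measQ: "measure lebesgue Q = (2 * e) ^ ?n"
      using e by (simp add: Q_def measure_cube)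
    have coord_prod_partials: "partials J (coord_prod G D) = coord_prod G (\<lambda>i. D i + count_list J i)" for J D
      unfolding G_def by (rule partials_coord_prod[OF deriv_seq_scaled_bump])
    have pu: "partials J u = coord_prod G (count_list (J @ I))" for J
    proof -
      have "(\<lambda>i. count_list I i + count_list J i) = count_list (J @ I)"
        by (simp add: fun_eq_iff count_list_append)
      then show ?thesis by (simp add: u_def \<psi>_def coord_prod_partials)
    qed
    have u_coord_prod: "u = coord_prod G (count_list I)"
      using pu[of "[]"] by simp
    have coord_prod0: "coord_prod G D x = 0" if "x \<notin> Q" for D x
      using that e unfolding G_def Q_def by (intro coord_prod_scaled_bump_eq_0)
    have test: "test_function \<Omega> (coord_prod G D)" for D
      using Q\<Omega> e unfolding G_def Q_def by (intro test_function_scaled_bump)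
    have bound: "\<bar>coord_prod G (count_list J) x\<bar> \<le> (1 / e) ^ length J * M ^ ?n * indicator Q x"
      if "length J \<le> m + k" for J x
    proof (cases "x \<in> Q")
      case True
      have "\<bar>coord_prod G (count_list J) x\<bar> \<le> (1 / e) ^ sum (count_list J) UNIV * M ^ ?n"
        unfolding G_def
      proof (rule abs_coord_prod_scaled_bump_le[OF e(1)], rule M(2))
        show "count_list J i \<le> m + k" for i
          using count_le_length[of J i] that by linarith
      qed
      then show ?thesis using True by (simp add: sum_count_list)
    qed (simp add: coord_prod0)

    \<comment> \<open>Since \<open>e \<le> 1\<close>, the power for the highest order
      \<open>m + k\<close> dominates those for all lower orders.\<close>
    define B where "B = (1 / e) ^ (m + k) * M ^ ?n"
    have B0: "0 \<le> B" using e M by (simp add: B_def)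
    have "sobolev_norm m p \<Omega> (\<lambda>x. d x powr (p - 1)) u \<le> ennreal (real (Suc m) *
        ((L * B) powr p * (A * e) powr (p - 1) * measure lebesgue Q) powr (1 / p))"
      unfolding L_def
    proof (rule sobolev_norm_le[where g = "\<lambda>J. partials J u"])
      show "is_weak_partial \<Omega> J u (partials J u)" for J
        using is_weak_partial_scaled_bump[of e z \<Omega> J] e Q\<Omega> unfolding u_coord_prod G_def Q_def by simp
      show "\<bar>partials J u x\<bar> \<le> B * indicator Q x" if "length J \<le> m" for J x
      proof -
        have "\<bar>partials J u x\<bar> \<le> (1 / e) ^ length (J @ I) * M ^ ?n * indicator Q x"
          unfolding pu by (rule bound) (use that in \<open>simp add: I_def\<close>)
        also have "\<dots> \<le> B * indicator Q x"
          unfolding B_def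
          by (intro mult_right_mono power_increasing)
             (use that e e_le_1 M in \<open>auto simp: I_def\<close>)
        finally show ?thesis .
      qed
      show "d x powr (p - 1) \<le> (A * e) powr (p - 1)" if "x \<in> Q" for x
        using dQ[OF that] e p by (intro powr_mono2) auto
    qed (use \<Omega> p B0 compQ lmeasurable_compact in auto)
    also have "real (Suc m) * ((L * B) powr p * (A * e) powr (p - 1) * measure lebesgue Q) powr (1 / p)
        = C * e powr ((N + p - 1) / p - real (m + k))"
    proof -
      have "L * B = (L * M ^ ?n) * e powr (- real (m + k))"
        unfolding B_def
        by (simp only: powr_minus powr_realpow[OF e(1)] power_one_over inverse_eq_divide mult_ac)
      then have "(L * B) powr p = (L * M ^ ?n) powr p * e powr (- real (m + k) * p)"
        using e M by (simp only:) (intro powr_monomial, auto simp: L_def)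
      moreover have "(A * e) powr (p - 1) = A powr (p - 1) * e powr (p - 1)"
        using A e by (simp add: powr_mult)
      moreover have "measure lebesgue Q = 2 ^ ?n * e powr N"
        using e by (simp add: measQ N_def powr_realpow power_mult_distrib)
      ultimately have "(L * B) powr p * (A * e) powr (p - 1) * measure lebesgue Q
          = ((L * M ^ ?n) powr p * A powr (p - 1) * 2 ^ ?n) * e powr (- real (m + k) * p + (p - 1) + N)"
        by (simp add: powr_add mult_ac)
      then have "((L * B) powr p * (A * e) powr (p - 1) * measure lebesgue Q) powr (1 / p)
          = ((L * M ^ ?n) powr p * A powr (p - 1) * 2 ^ ?n) powr (1 / p)
            * e powr ((- real (m + k) * p + (p - 1) + N) * (1 / p))"
        using e by (simp only:) (intro powr_monomial, auto)
      moreover have "(- real (m + k) * p + (p - 1) + N) * (1 / p) = (N + p - 1) / p - real (m + k)"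
        using p by (simp add: field_simps)
      ultimately show ?thesis by (simp add: C_def)
    qed
    finally have upper: "sobolev_norm m p \<Omega> (\<lambda>x. d x powr (p - 1)) u
        \<le> ennreal (C * e powr ((N + p - 1) / p - real (m + k)))" .

    \<comment> \<open>On this subcube every factor of \<open>u\<close> is bounded away from 0. On
      the rest of \<open>Q\<close> the integrand \<open>F\<close> is merely nonnegative, which is
      enough.\<close>
    define Q' where "Q' = cube z (\<alpha> * e) (\<beta> * e)"
    have Q'Q: "Q' \<subseteq> Q"
    proof -
      have "- e \<le> \<alpha> * e" "\<beta> * e \<le> e"
        using e(1) \<alpha>\<beta> mult_right_mono[of "- 1" \<alpha> e] mult_right_mono[of \<beta> 1 e] by auto
      then show ?thesis
        unfolding Q_def Q'_def subset_iff mem_cube atLeastAtMost_iff by (meson order_trans)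
    qed
    have measQ': "measure lebesgue Q' = ((\<beta> - \<alpha>) * e) ^ ?n"
      using e \<alpha>\<beta> unfolding Q'_def by (subst measure_cube) (auto simp: algebra_simps)
    \<comment> \<open>The smallest possible value of \<open>F\<close> on \<open>Q'\<close>: the
      lower bound of \<open>\<bar>u\<bar>\<close> squared, over the upper bound \<open>A * e\<close>
      of \<open>d\<close> to the power \<open>m - k\<close>.\<close>
    define b where "b = ((1 / e) ^ k * \<kappa> ^ ?n)\<^sup>2 / (A * e) ^ (m - k)"
    define F where "F x = (u x)\<^sup>2 / d x ^ (m - k)" for x
    have F_ge: "b * indicator Q' x \<le> indicator Q x * F x" for x
    proof (cases "x \<in> Q'")
      case True
      then have xQ: "x \<in> Q" using Q'Q by blast
      have "(1 / e) ^ sum (count_list I) UNIV * \<kappa> ^ ?n \<le> \<bar>u x\<bar>"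
        unfolding u_coord_prod G_def
        by (rule abs_coord_prod_scaled_bump_ge[OF e(1) \<kappa>(1) True[unfolded Q'_def]])
           (use \<kappa>(2) in \<open>auto simp: I_def count_list_replicate\<close>)
      then have "(1 / e) ^ k * \<kappa> ^ ?n \<le> \<bar>u x\<bar>"
        by (simp add: sum_count_list I_def)
      then have "((1 / e) ^ k * \<kappa> ^ ?n)\<^sup>2 \<le> \<bar>u x\<bar>\<^sup>2"
        using e \<kappa> by (intro power_mono) auto
      moreover have "0 < d x ^ (m - k)" "d x ^ (m - k) \<le> (A * e) ^ (m - k)"
        using dQ[OF xQ] e by (auto intro!: power_mono)
      ultimately have "b \<le> F x"
        unfolding b_def F_def by (intro frac_le) auto
      then show ?thesis using True xQ by simp
    next
      case False
      have "0 \<le> indicator Q x * F x"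
        using dpos[of x] Q\<Omega> by (cases "x \<in> Q") (auto simp: F_def)
      then show ?thesis using False by simp
    qed
    have cont_u: "continuous_on UNIV u"
      using test smooth_on_continuous[of u "[]"] by (simp add: u_coord_prod test_function_def)
    have cont_d: "continuous_on Q d"
      using smooth_on_differentiable[OF dsm, of _ "[]"] Q\<Omega>
      by (auto intro!: continuous_at_imp_continuous_on differentiable_imp_continuous_within)
    have "integrable lborel (\<lambda>x. indicator Q x *\<^sub>R F x)"
      unfolding F_def using dQ e
      by (intro borel_integrable_compact[OF compQ] continuous_intros cont_d
          continuous_on_subset[OF cont_u]) force+
    then have F_int: "integrable lebesgue (\<lambda>x. indicator Q x * F x)"
      by (simp add: integrable_completion[OF borel_measurable_integrable])
    have "b * ((\<beta> - \<alpha>) * e) ^ ?n = (\<integral>x. b * indicator Q' x \<partial>lebesgue)"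
      using measQ' by (simp add: Q'_def cube_def)
    also have "\<dots> \<le> (\<integral>x. indicator Q x * F x \<partial>lebesgue)"
    proof (rule integral_mono[OF _ F_int F_ge])
      show "integrable lebesgue (\<lambda>x. b * indicator Q' x)"
        using lmeasurable_compact[OF compact_cube]
        by (intro integrable_mult_right integrable_real_indicator)
           (auto simp: Q'_def fmeasurable_def)
    qed
    also have "\<dots> = (LINT x:\<Omega>|lebesgue. u x / d x ^ (m - k) * partials I \<psi> x)"
      unfolding set_lebesgue_integral_def
    proof (rule Bochner_Integration.integral_cong[OF refl])
      fix x
      show "indicator Q x * F x = indicator \<Omega> x *\<^sub>R (u x / d x ^ (m - k) * partials I \<psi> x)"
        using Q\<Omega> coord_prod0[of x "count_list I"]
        by (cases "x \<in> Q") (auto simp: F_def power2_eq_square u_coord_prod[symmetric] u_def[symmetric])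
    qed
    finally have low: "b * ((\<beta> - \<alpha>) * e) ^ ?n \<le> \<bar>LINT x:\<Omega>|lebesgue. u x / d x ^ (m - k) * partials I \<psi> x\<bar>"
      by linarith
    have bpos: "0 < b * ((\<beta> - \<alpha>) * e) ^ ?n"
      using e \<kappa> A \<alpha>\<beta> by (simp add: b_def)
    have "ennreal ((cr * e powr r * (b * ((\<beta> - \<alpha>) * e) ^ ?n / (2 * M ^ ?n * measure lebesgue Q)) powr q
        * measure lebesgue Q) powr (1 / q))
      \<le> sobolev_norm k q \<Omega> (\<lambda>x. d x powr r) (\<lambda>x. u x / d x ^ (m - k))"
    proof (rule sobolev_norm_ge[where I = I and \<psi> = \<psi>, OF \<Omega> q])
      show "I \<noteq> []" "length I = k" using k by (auto simp: I_def)
      show "test_function \<Omega> \<psi>" unfolding \<psi>_def by (rule test)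
      show "\<bar>\<psi> x\<bar> \<le> M ^ ?n * indicator Q x" for x
      proof -
        have "count_list [] = (\<lambda>_::'n. 0)" by auto
        then show ?thesis using bound[of "[]" x] by (simp add: \<psi>_def)
      qed
      show "cr * e powr r \<le> d x powr r" if "x \<in> Q" for x
      proof (cases "r \<ge> 0")
        case True
        have "cr * e powr r \<le> 1 * e powr r"
          by (intro mult_right_mono) (auto simp: cr_def)
        also have "\<dots> \<le> d x powr r"
          using dQ[OF that] e True by (simp add: powr_mono2)
        finally show ?thesis .
      next
        case False
        have "cr * e powr r \<le> A powr r * e powr r"
          by (intro mult_right_mono) (auto simp: cr_def)
        also have "\<dots> = (A * e) powr r" using A e by (simp add: powr_mult)
        also have "\<dots> \<le> d x powr r"
          using dQ[OF that] e False by (intro powr_mono2') auto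
        finally show ?thesis .
      qed
    qed (use M Q\<Omega> compQ e cpos bpos low in \<open>auto simp: measQ\<close>)
    moreover have "(cr * e powr r * (b * ((\<beta> - \<alpha>) * e) ^ ?n / (2 * M ^ ?n * measure lebesgue Q)) powr q
        * measure lebesgue Q) powr (1 / q) = c * e powr ((N + r) / q - real (m + k))"
    proof -
      \<comment> \<open>Twice \<open>k\<close> from the square of \<open>u\<close> and
        \<open>m - k\<close> from the quotient add up to the exponent \<open>m + k\<close> of the
        upper bound.\<close>
      have ek: "e ^ (2 * k) * e ^ (m - k) = e powr real (m + k)"
      proof -
        have "2 * k + (m - k) = m + k" using k by simp
        then show ?thesis
          by (simp only: powr_realpow[OF e(1)] flip: power_add)
      qed
      have "((1 / e) ^ k)\<^sup>2 = inverse (e ^ (2 * k))"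
        by (simp add: power_divide inverse_eq_divide mult.commute[of 2] flip: power_mult)
      then have "b * ((\<beta> - \<alpha>) * e) ^ ?n / (2 * M ^ ?n * measure lebesgue Q)
          = c1 * inverse (e ^ (2 * k) * e ^ (m - k))"
        using e A M(1) by (simp add: b_def c1_def measQ power_mult_distrib) (simp add: field_simps)
      also have "\<dots> = c1 * e powr (- real (m + k))"
        unfolding ek powr_minus ..
      finally have "(b * ((\<beta> - \<alpha>) * e) ^ ?n / (2 * M ^ ?n * measure lebesgue Q)) powr q
          = c1 powr q * e powr (- real (m + k) * q)"
        using e cpos by (simp only:) (intro powr_monomial, auto)
      moreover have "measure lebesgue Q = 2 ^ ?n * e powr N"
        using e by (simp add: measQ N_def powr_realpow power_mult_distrib)
      ultimately have "cr * e powr r * (b * ((\<beta> - \<alpha>) * e) ^ ?n / (2 * M ^ ?n * measure lebesgue Q)) powr q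
          * measure lebesgue Q = (cr * c1 powr q * 2 ^ ?n) * e powr (r + - real (m + k) * q + N)"
        by (simp add: powr_add mult_ac)
      then have "(cr * e powr r * (b * ((\<beta> - \<alpha>) * e) ^ ?n / (2 * M ^ ?n * measure lebesgue Q)) powr q
          * measure lebesgue Q) powr (1 / q) = c * e powr ((r + - real (m + k) * q + N) * (1 / q))"
        unfolding c_def using e cpos by (simp only:) (intro powr_monomial, auto)
      moreover have "(r + - real (m + k) * q + N) * (1 / q) = (N + r) / q - real (m + k)"
        using q by (simp add: field_simps)
      ultimately show ?thesis by simp
    qed
    ultimately have lower: "ennreal (c * e powr ((N + r) / q - real (m + k)))
        \<le> sobolev_norm k q \<Omega> (\<lambda>x. d x powr r) (\<lambda>x. u x / d x ^ (m - k))"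
      by (simp only:)
    have "u \<in> sobolev_space0 m p \<Omega> (\<lambda>x. d x powr (p - 1))"
      using p test upper unfolding u_coord_prod
      by (intro test_function_in_sobolev_space0[OF \<Omega>]) (auto intro: le_less_trans)
    then show ?thesis using upper lower by blast
  qed
  have "\<forall>\<^sub>F e in at_right 0. e < min (1 / (N + 1)) (e1 / A)"
    using N A e1(1) by (intro eventually_at_right_less[THEN eventually_mono] order_tendstoD(2)[OF tendsto_ident_at]) auto
  then have "\<forall>\<^sub>F e in at_right 0. 0 < e \<and> (N + 1) * e \<le> 1 \<and> A * e < e1"
    using eventually_at_right_less[of "0::real"]
    by eventually_elim (use N A in \<open>auto simp: field_simps\<close>)
  then have "\<forall>\<^sub>F e in at_right 0. \<exists>u\<in>sobolev_space0 m p \<Omega> (\<lambda>x. d x powr (p - 1)).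
      sobolev_norm m p \<Omega> (\<lambda>x. d x powr (p - 1)) u
        \<le> ennreal (C * e powr ((N + p - 1) / p - real (m + k))) \<and>
      ennreal (c * e powr ((N + r) / q - real (m + k)))
        \<le> sobolev_norm k q \<Omega> (\<lambda>x. d x powr r) (\<lambda>x. u x / d x ^ (m - k))"
    by (rule eventually_mono) (use main in blast)
  then show ?thesis
    using cpos(3) unfolding N_def by blast
qed

theorem proposition3p3:
  fixes m k :: nat and p q r :: real
  assumes "m \<ge> 2" and "1 \<le> k" and "k \<le> m - 1"
    and "1 \<le> p" and "p \<le> q"
    and "r < q / p * (real CARD('n::finite) - 1) - real CARD('n) + q"
  shows "\<exists>\<Omega> :: (real^'n) set. bounded \<Omega> \<and> open \<Omega> \<and> smooth_boundary \<Omega> \<and>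
    (\<exists>d. regularised_distance \<Omega> d) \<and>
    (\<forall>d. regularised_distance \<Omega> d \<longrightarrow>
      \<not> (\<exists>C::real. \<forall>u \<in> sobolev_space0 m p \<Omega> (\<lambda>x. d x powr (p - 1)).
            sobolev_norm k q \<Omega> (\<lambda>x. d x powr r) (\<lambda>x. u x / d x ^ (m - k))
              \<le> ennreal C * sobolev_norm m p \<Omega> (\<lambda>x. d x powr (p - 1)) u))"
proof (intro exI[of _ "ball 0 1"] conjI allI impI notI)
  fix d :: "real^'n \<Rightarrow> real"
  let ?\<Omega> = "ball (0 :: real^'n) 1" and ?n = "real CARD('n)"
  assume d: "regularised_distance ?\<Omega> d"
    and "\<exists>C::real. \<forall>u \<in> sobolev_space0 m p ?\<Omega> (\<lambda>x. d x powr (p - 1)).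
            sobolev_norm k q ?\<Omega> (\<lambda>x. d x powr r) (\<lambda>x. u x / d x ^ (m - k))
              \<le> ennreal C * sobolev_norm m p ?\<Omega> (\<lambda>x. d x powr (p - 1)) u"
  then obtain C0 where C0: "\<And>u. u \<in> sobolev_space0 m p ?\<Omega> (\<lambda>x. d x powr (p - 1)) \<Longrightarrow>
            sobolev_norm k q ?\<Omega> (\<lambda>x. d x powr r) (\<lambda>x. u x / d x ^ (m - k))
              \<le> ennreal C0 * sobolev_norm m p ?\<Omega> (\<lambda>x. d x powr (p - 1)) u"
    by blast
  define a where "a = (?n + r) / q - real (m + k)"
  define b where "b = (?n + p - 1) / p - real (m + k)"
  \<comment> \<open>\<open>ennreal\<close> sends negative reals to 0, so \<open>K\<close> gives the
    same bound as \<open>C0\<close>; being nonnegative, it allows the return to real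
    inequalities.\<close>
  define K where "K = max C0 0"
  have pq: "0 < p" "0 < q" and q1: "1 \<le> q" and km: "k \<le> m" using assms by auto
  have "(?n + r) / q < (q / p * (?n - 1) + q) / q"
    using assms(6) pq by (intro divide_strict_right_mono) auto
  also have "\<dots> = (?n + p - 1) / p" using pq by (simp add: field_simps)
  finally have ab: "a < b" by (simp add: a_def b_def)
  have C0K: "ennreal C0 = ennreal K"
    by (simp add: K_def max_def ennreal_neg)
  obtain c C where c: "0 < c" and ev: "\<forall>\<^sub>F e in at_right 0. \<exists>u\<in>sobolev_space0 m p ?\<Omega> (\<lambda>x. d x powr (p - 1)).
      sobolev_norm m p ?\<Omega> (\<lambda>x. d x powr (p - 1)) u \<le> ennreal (C * e powr b) \<and>
      ennreal (c * e powr a) \<le> sobolev_norm k q ?\<Omega> (\<lambda>x. d x powr r) (\<lambda>x. u x / d x ^ (m - k))"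
    using boundary_bump_norms[OF d assms(2) km assms(4) q1, of r] unfolding a_def b_def by blast
  have "\<forall>\<^sub>F e in at_right 0. c \<le> K * (\<bar>C\<bar> * e powr (b - a))"
    using ev eventually_at_right_less[of "0::real"]
  proof eventually_elim
    case (elim e)
    then obtain u where u: "u \<in> sobolev_space0 m p ?\<Omega> (\<lambda>x. d x powr (p - 1))"
      "sobolev_norm m p ?\<Omega> (\<lambda>x. d x powr (p - 1)) u \<le> ennreal (C * e powr b)"
      "ennreal (c * e powr a) \<le> sobolev_norm k q ?\<Omega> (\<lambda>x. d x powr r) (\<lambda>x. u x / d x ^ (m - k))"
      by blast
    have "ennreal (c * e powr a) \<le> ennreal K * ennreal (C * e powr b)"
      using order_trans[OF u(3) C0[OF u(1)]] mult_left_mono[OF u(2), of "ennreal K"]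
      unfolding C0K by auto
    also have "\<dots> \<le> ennreal K * ennreal (\<bar>C\<bar> * e powr b)"
      by (intro mult_left_mono ennreal_leI mult_right_mono) auto
    finally have "c * e powr a \<le> K * (\<bar>C\<bar> * e powr b)"
      by (simp add: K_def flip: ennreal_mult)
    \<comment> \<open>This leaves the constant \<open>c\<close> on the left and the positive power
      \<open>e powr (b - a)\<close> on the right; letting \<open>e\<close> tend to 0 then forces
      \<open>c \<le> 0\<close>.\<close>
    then have "c * e powr a * e powr (- a) \<le> K * (\<bar>C\<bar> * e powr b) * e powr (- a)"
      by (rule mult_right_mono) simp
    then show ?case
      using elim(2) by (simp add: mult.assoc flip: powr_add)
  qed
  moreover have "((\<lambda>e. K * (\<bar>C\<bar> * e powr (b - a))) \<longlongrightarrow> K * (\<bar>C\<bar> * 0)) (at_right 0)"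
  proof (intro tendsto_mult_left)
    show "((\<lambda>e::real. e powr (b - a)) \<longlongrightarrow> 0) (at_right 0)"
      using ab by real_asymp
  qed
  ultimately have "c \<le> K * (\<bar>C\<bar> * 0)"
    by (intro tendsto_lowerbound) auto
  with c show False by simp
qed (auto simp: smooth_boundary_unit_ball regularised_distance_unit_ball)

end
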